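(* Let $p$ be an odd prime such that $p\equiv1,5,19,23\pmod{24}$. Then $$\sum_{k=0}^{p-1}\frac{\binom{2k}{k}^2\binom{4k}{2k}}{28^{4k}}\equiv\begin{cases}4x^2\pmod p&\text{if } p\equiv1,19\pmod{24}\text{ and so } p=x^2+18y^2\text{ with } x,y\in\mathbb{Z},\\ 0\pmod{p^2}&\text{if } p\equiv5,23\pmod{24}.\end{cases}$$
   Context: Congruences between rational numbers modulo $p$ or $p^2$ are taken in the ring of rationals whose denominators are coprime to $p$. *)

theory Defs
  imports Complex_Main "HOL-Computational_Algebra.Primes"
begin

text \<open>\<^const>\<open>quotient_of\<close> returns the reduced fraction, so this is the ring of rationals whose
  denominators (in lowest terms) are coprime to \<open>p\<close>.\<close>

definition p_integers :: "nat \<Rightarrow> rat set" where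
  "p_integers p = {r. coprime (snd (quotient_of r)) (int p)}"

text \<open>Congruence modulo the ideal generated by \<open>p ^ e\<close> in that ring. The type \<^typ>\<open>rat\<close> is a field,
  so divisibility has to be witnessed inside \<^term>\<open>p_integers p\<close>; both sides are required to lie in
  the ring.\<close>

definition rat_cong_pow :: "rat \<Rightarrow> rat \<Rightarrow> nat \<Rightarrow> nat \<Rightarrow> bool" where
  "rat_cong_pow a b p e \<longleftrightarrow>
     a \<in> p_integers p \<and> b \<in> p_integers p \<and> (\<exists>c\<in>p_integers p. a - b = of_nat p ^ e * c)"

end

theory Submission
  imports Defs "HOL-Number_Theory.Number_Theory" "HOL-Computational_Algebra.Computational_Algebra"
begin

text \<open>
  Write \<open>a\<^sub>k = (2k choose k) (4k choose 2k)\<close> and \<open>b\<^sub>k = (2k choose k) a\<^sub>k\<close>, so that the sum in question is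
  \<open>\<Sum> b\<^sub>k / 28^(4k)\<close>. The proof combines a \<open>p\<close>-adic Clausen formula with complex multiplication.

  \<^item> \<open>clausen_truncated\<close>: \<open>\<Sum>\<^bsub>k<p\<^esub> b\<^sub>k (x (1 - 64 x))^k \<equiv> (\<Sum>\<^bsub>k<p\<^esub> a\<^sub>k x^k)^2\<close> modulo \<open>p^2\<close>. For
    the full power series this is Clausen's formula, since both sides solve the same third order
    differential equation; in the truncated identity, the coefficients of degree at least \<open>p\<close> are
    divisible by \<open>p^2\<close> on both sides. Hence the sum is
    \<open>f(x)^2\<close> modulo \<open>p^2\<close>, where \<open>f(x) = \<Sum>\<^bsub>k<p\<^esub> a\<^sub>k x^k\<close> and \<open>28^4 x (1 - 64 x) \<equiv> 1\<close>. The root \<open>x\<close> lies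
    in \<open>\<rat>(\<surd>6)\<close>, and \<open>6\<close> is a square modulo \<open>p\<close> for the given residue classes.

  \<^item> \<open>H_cong_hypergeometric\<close>: modulo \<open>p\<close>, \<open>f(x)\<close> is up to sign the Hasse invariant of an elliptic curve
    \<open>Y^2 = X^3 + 28 X^2 + (18 + 80 q) X\<close>, where \<open>2 q^2 = 4 q + 1\<close>. This curve has complex multiplication
    by \<open>\<int>[3 \<surd>-2]\<close>, and there is a 3-isogeny from \<open>Y^2 = X^3 + 4 X^2 + 2 X\<close>, which has complex
    multiplication by \<open>\<int>[\<surd>-2]\<close>. Normalized isogenies preserve the Hasse invariant, so both curves have
    the same one (\<open>H_isogeny\<close>). The invariance is proved with coefficients of power series modulo
    \<open>p\<close>, which is the action of the Cartier operator on the invariant differential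
    (\<open>hasse_invariant_isogeny\<close>).

  \<^item> The Hasse invariant of the second curve is minus the sum of the quadratic character over the values
    \<open>y^3 + 4 y^2 + 2 y\<close> (\<open>cubic_sum_cong\<close>). The 2-isogeny of this curve to its twist by \<open>-2\<close> shows that
    the character sum vanishes if \<open>-2\<close> is not a square modulo \<open>p\<close> (\<open>cubic_sum_twist\<close>); then
    \<open>p\<close> divides \<open>f(x)\<close> and \<open>p^2\<close> divides \<open>f(x)^2\<close>.

  \<^item> If \<open>-2\<close> is a square, the character sum equals \<open>2 a\<close> with \<open>p = a^2 + 2 b^2\<close>
    (\<open>cubic_sum_norm_equation\<close>). This is an argument in the style of Jacobsthal: twice the sum is a
    member of a family indexed by \<open>\<int>[i]\<close> modulo \<open>p\<close>, whose members take up to sign only three values, one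
    of them \<open>0\<close>, and whose second moment can be computed. When \<open>p \<equiv> 1\<close> modulo \<open>3\<close>, the
    number \<open>b\<close> is divisible by \<open>3\<close>, which turns \<open>a^2 + 2 b^2\<close> into \<open>x^2 + 18 y^2\<close>, and \<open>x^2\<close> is
    determined by \<open>p\<close> (\<open>representation_unique\<close>).
\<close>

section \<open>A truncated Clausen formula\<close>

unbundle fps_syntax

lemma central_binomial_Suc: "Suc j * ((2 * Suc j) choose Suc j) = (4 * j + 2) * ((2 * j) choose j)"
proof -
  have "Suc j * ((2 * Suc j) choose Suc j) = 2 * Suc j * ((2 * j + 1) choose j)"
    using Suc_times_binomial[of j "2 * j + 1"] by simp
  hence "Suc j * (Suc j * ((2 * Suc j) choose Suc j)) = Suc j * (2 * Suc j * ((2 * j + 1) choose j))"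
    by (rule arg_cong)
  moreover have "Suc j * ((2 * j + 1) choose j) = (2 * j + 1) * ((2 * j) choose j)"
    using binomial_absorb_comp[of "2 * j + 1" j] by simp
  from arg_cong[OF this, of "\<lambda>t. 2 * Suc j * t"]
  have "Suc j * (2 * Suc j * ((2 * j + 1) choose j)) = 2 * Suc j * ((2 * j + 1) * ((2 * j) choose j))"
    by (simp only: ac_simps)
  moreover have "2 * Suc j * ((2 * j + 1) * c) = Suc j * ((4 * j + 2) * c)" for c
    by (simp add: algebra_simps)
  ultimately have "Suc j * (Suc j * ((2 * Suc j) choose Suc j)) = Suc j * ((4 * j + 2) * ((2 * j) choose j))"
    by (simp only:)
  thus ?thesis by (simp only: mult_left_cancel)
qed

text \<open>The coefficients \<open>a\<^sub>k = (4k)! / ((2k)! k!^2)\<close> of the hypergeometric series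
  \<open>2F1(1/4, 3/4; 1; 64 x)\<close>.\<close>

definition acoeff :: "nat \<Rightarrow> int" where
  "acoeff k = int ((2 * k) choose k) * int ((4 * k) choose (2 * k))"

text \<open>The coefficients \<open>b\<^sub>k = (4k)! / k!^4\<close> of the hypergeometric series
  \<open>3F2(1/4, 1/2, 3/4; 1, 1; 256 x)\<close>.\<close>

definition bcoeff :: "nat \<Rightarrow> int" where
  "bcoeff k = int ((2 * k) choose k) ^ 2 * int ((4 * k) choose (2 * k))"

lemma central_binomial_Suc_int:
  "(int j + 1) * int ((2 * Suc j) choose Suc j) = (4 * int j + 2) * int ((2 * j) choose j)"
proof -
  have "int (Suc j * ((2 * Suc j) choose Suc j)) = int ((4 * j + 2) * ((2 * j) choose j))"
    by (rule arg_cong[OF central_binomial_Suc])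
  thus ?thesis by (simp only: of_nat_mult of_nat_Suc of_nat_add of_nat_numeral add.commute)
qed

lemma quarter_binomial_Suc:
  "(int k + 1) * (2 * int k + 1) * int ((4 * Suc k) choose (2 * Suc k))
     = 2 * (4 * int k + 1) * (4 * int k + 3) * int ((4 * k) choose (2 * k))"
proof -
  let ?c = "int ((2 * (2 * k)) choose (2 * k))" and ?d = "int ((2 * Suc (2 * k)) choose Suc (2 * k))"
  let ?e = "int ((2 * Suc (Suc (2 * k))) choose Suc (Suc (2 * k)))"
  have 1: "(2 * int k + 1) * ?d = (8 * int k + 2) * ?c" using central_binomial_Suc_int[of "2 * k"] by simp
  have 2: "(2 * int k + 2) * ?e = (8 * int k + 6) * ?d"
    using central_binomial_Suc_int[of "Suc (2 * k)"] by (simp add: algebra_simps)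
  have "2 * ((int k + 1) * (2 * int k + 1) * ?e) = (2 * int k + 1) * ((2 * int k + 2) * ?e)"
    by (simp add: algebra_simps)
  also have "\<dots> = (8 * int k + 6) * ((2 * int k + 1) * ?d)" unfolding 2 by (simp only: ac_simps)
  also have "\<dots> = 2 * (2 * (4 * int k + 1) * (4 * int k + 3) * ?c)" unfolding 1 by (simp add: algebra_simps)
  finally have "(int k + 1) * (2 * int k + 1) * ?e = 2 * (4 * int k + 1) * (4 * int k + 3) * ?c"
    by (simp only: mult_left_cancel)
  moreover have "2 * Suc (Suc (2 * k)) = 4 * Suc k" "Suc (Suc (2 * k)) = 2 * Suc k" "2 * (2 * k) = 4 * k" by simp_all
  ultimately show ?thesis by (simp only:)
qed

lemma acoeff_Suc:
  "(int k + 1) ^ 2 * acoeff (Suc k) = 4 * (4 * int k + 1) * (4 * int k + 3) * acoeff k"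
proof -
  let ?b = "int ((2 * Suc k) choose Suc k)" and ?d = "int ((4 * Suc k) choose (2 * Suc k))"
  have "(2 * int k + 1) * ((int k + 1) ^ 2 * acoeff (Suc k))
      = ((int k + 1) * ?b) * ((int k + 1) * (2 * int k + 1) * ?d)"
    unfolding acoeff_def power2_eq_square by (simp only: ac_simps)
  also have "\<dots> = (2 * int k + 1) * (4 * (4 * int k + 1) * (4 * int k + 3) * acoeff k)"
    unfolding central_binomial_Suc_int quarter_binomial_Suc acoeff_def by (simp add: algebra_simps)
  finally show ?thesis by (subst (asm) mult_left_cancel) linarith
qed

lemma bcoeff_eq: "bcoeff k = int ((2 * k) choose k) * acoeff k"
  by (simp add: bcoeff_def acoeff_def power2_eq_square)

lemma bcoeff_Suc:
  "(int k + 1) ^ 3 * bcoeff (Suc k) = 8 * (2 * int k + 1) * (4 * int k + 1) * (4 * int k + 3) * bcoeff k"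
proof -
  have "(int k + 1) ^ 3 * bcoeff (Suc k)
      = ((int k + 1) * int ((2 * Suc k) choose Suc k)) * ((int k + 1) ^ 2 * acoeff (Suc k))"
    unfolding bcoeff_eq power2_eq_square power3_eq_cube by (simp only: ac_simps)
  also have "\<dots> = 8 * (2 * int k + 1) * (4 * int k + 1) * (4 * int k + 3) * bcoeff k"
    unfolding central_binomial_Suc_int acoeff_Suc bcoeff_eq by (simp add: algebra_simps)
  finally show ?thesis .
qed

text \<open>The two generating functions, and the argument \<open>x (1 - 64 x)\<close> at which the second one is the
  square of the first.\<close>

definition square_root_series :: "int fps" where "square_root_series = Abs_fps acoeff"
definition cubic_series :: "int fps" where "cubic_series = Abs_fps bcoeff"
definition clausen_arg :: "int fps" where "clausen_arg = fps_X - 64 * fps_X ^ 2"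

lemma z_mult_nth: "(clausen_arg * h) $ Suc n = h $ n - 64 * (if n = 0 then 0 else h $ (n - 1))"
proof -
  have "clausen_arg * h = fps_X * h - fps_const 64 * (fps_X * (fps_X * h))"
    by (simp add: clausen_arg_def algebra_simps power2_eq_square numeral_fps_const)
  thus ?thesis by (cases n) simp_all
qed

lemma z_mult_nth_0: "(clausen_arg * h) $ 0 = 0"
  by (simp add: clausen_arg_def)

lemma deriv_z_mult_nth:
  "fps_deriv (clausen_arg * h) $ n = (int n + 1) * (h $ n - 64 * (if n = 0 then 0 else h $ (n - 1)))"
proof -
  have "fps_deriv (clausen_arg * h) $ n = (int n + 1) * (clausen_arg * h) $ Suc n"
    by (simp only: fps_deriv_nth Suc_eq_plus1 of_nat_add of_nat_1)
  thus ?thesis by (simp only: z_mult_nth)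
qed

text \<open>The hypergeometric equation, in the form \<open>(z F')' = 12 F\<close> with \<open>z = x - 64 x^2\<close>.\<close>

lemma square_root_series_ode: "fps_deriv (clausen_arg * fps_deriv square_root_series) = 12 * square_root_series"
proof (rule fps_ext)
  fix n
  have n1: "(if n = 0 then 0 else fps_deriv square_root_series $ (n - 1)) = int n * acoeff n"
    by (cases n) (simp_all add: square_root_series_def)
  have "fps_deriv (clausen_arg * fps_deriv square_root_series) $ n = (int n + 1) ^ 2 * acoeff (Suc n) - 64 * int n * (int n + 1) * acoeff n"
    unfolding deriv_z_mult_nth n1 by (simp add: square_root_series_def power2_eq_square algebra_simps)
  also have "\<dots> = 12 * acoeff n" unfolding acoeff_Suc by (simp add: algebra_simps)
  also have "\<dots> = (12 * square_root_series) $ n" by (simp add: square_root_series_def numeral_fps_const)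
  finally show "fps_deriv (clausen_arg * fps_deriv square_root_series) $ n = (12 * square_root_series) $ n" .
qed

text \<open>The symmetric square of the hypergeometric equation.\<close>

lemma square_ode:
  "fps_deriv (clausen_arg * fps_deriv (clausen_arg * fps_deriv (square_root_series ^ 2))) = 48 * (clausen_arg * fps_deriv (square_root_series ^ 2)) + 24 * (fps_deriv clausen_arg * square_root_series ^ 2)"
proof -
  define u where "u = clausen_arg * fps_deriv square_root_series"
  have du: "fps_deriv u = 12 * square_root_series" unfolding u_def by (rule square_root_series_ode)
  have 1: "clausen_arg * fps_deriv (square_root_series ^ 2) = 2 * (square_root_series * u)"
    by (simp add: u_def power2_eq_square algebra_simps)
  have 2: "clausen_arg * fps_deriv (clausen_arg * fps_deriv (square_root_series ^ 2)) = 2 * u ^ 2 + 24 * (clausen_arg * square_root_series ^ 2)"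
  proof -
    have "clausen_arg * fps_deriv (2 * (square_root_series * u)) = 2 * (u * (clausen_arg * fps_deriv square_root_series)) + 24 * (clausen_arg * square_root_series ^ 2)"
      by (simp add: du power2_eq_square algebra_simps)
    thus ?thesis unfolding 1 u_def[symmetric] by (simp add: power2_eq_square)
  qed
  show ?thesis
  proof -
    have "fps_deriv (2 * u ^ 2 + 24 * (clausen_arg * square_root_series ^ 2))
        = 48 * (square_root_series * u) + 48 * (square_root_series * (clausen_arg * fps_deriv square_root_series)) + 24 * (fps_deriv clausen_arg * square_root_series ^ 2)"
      by (simp add: du power2_eq_square algebra_simps)
    thus ?thesis unfolding 2 unfolding 1 u_def[symmetric] by simp
  qed
qed

text \<open>The third order equation of the second series in terms of the Euler operator: \<open>P\<close> and \<open>N\<close>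
  are its first and second Euler derivatives.\<close>

lemma cubic_series_ode:
  fixes P N :: "int fps"
  defines "P \<equiv> fps_X * fps_deriv cubic_series"
  defines "N \<equiv> fps_X * fps_deriv P"
  shows "fps_deriv ((1 - 256 * fps_X) * N - 128 * (fps_X * P)) = 48 * P + 24 * cubic_series"
proof (rule fps_ext)
  fix n
  have P: "P $ k = int k * bcoeff k" for k by (cases k) (simp_all add: P_def cubic_series_def)
  have N: "N $ k = int k ^ 2 * bcoeff k" for k by (cases k) (simp_all add: N_def P power2_eq_square)
  have "(1 - 256 * fps_X) * N - 128 * (fps_X * P) = N - fps_const 256 * (fps_X * N) - fps_const 128 * (fps_X * P)"
    by (simp add: algebra_simps numeral_fps_const)
  hence "fps_deriv ((1 - 256 * fps_X) * N - 128 * (fps_X * P)) $ n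
      = (int n + 1) * ((int n + 1) ^ 2 * bcoeff (Suc n) - 256 * (int n ^ 2 * bcoeff n) - 128 * (int n * bcoeff n))"
    by (simp add: N P add.commute del: fps_deriv_sub fps_deriv_mult)
  also have "\<dots> = (int n + 1) ^ 3 * bcoeff (Suc n) - (int n + 1) * (256 * int n ^ 2 + 128 * int n) * bcoeff n"
    by (simp add: power2_eq_square power3_eq_cube algebra_simps)
  also have "\<dots> = 48 * (int n * bcoeff n) + 24 * bcoeff n"
    unfolding bcoeff_Suc by (simp add: power2_eq_square algebra_simps)
  also have "\<dots> = (48 * P + 24 * cubic_series) $ n"
    by (simp add: P cubic_series_def numeral_fps_const)
  finally show "fps_deriv ((1 - 256 * fps_X) * N - 128 * (fps_X * P)) $ n = (48 * P + 24 * cubic_series) $ n" .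
qed

text \<open>Substituting \<open>z = x - 64 x^2\<close> in that equation gives the symmetric square, because
  \<open>w = z'\<close> satisfies \<open>w^2 = 1 - 256 z\<close>.\<close>

lemma cubic_compose_ode:
  "fps_deriv (clausen_arg * fps_deriv (clausen_arg * fps_deriv (cubic_series oo clausen_arg))) = 48 * (clausen_arg * fps_deriv (cubic_series oo clausen_arg)) + 24 * (fps_deriv clausen_arg * (cubic_series oo clausen_arg))"
proof -
  define P where "P = fps_X * fps_deriv cubic_series"
  define N where "N = fps_X * fps_deriv P"
  define M where "M = (1 - 256 * fps_X) * N - 128 * (fps_X * P)"
  define w where "w = fps_deriv clausen_arg"
  have z0: "clausen_arg $ 0 = 0" by (simp add: clausen_arg_def)
  have w: "w = 1 - 128 * fps_X" by (simp add: w_def clausen_arg_def power2_eq_square algebra_simps)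
  have w2: "w * w = 1 - 256 * clausen_arg" by (simp add: w clausen_arg_def power2_eq_square algebra_simps)
  have dw: "fps_deriv w = - 128" by (simp add: w)
  have Pz: "P oo clausen_arg = clausen_arg * (fps_deriv cubic_series oo clausen_arg)" using z0 by (simp add: P_def fps_compose_mult_distrib)
  have Nz: "N oo clausen_arg = clausen_arg * (fps_deriv P oo clausen_arg)" using z0 by (simp add: N_def fps_compose_mult_distrib)
  have Mz: "M oo clausen_arg = (1 - 256 * clausen_arg) * (N oo clausen_arg) - 128 * (clausen_arg * (P oo clausen_arg))"
    using z0 by (simp add: M_def fps_compose_mult_distrib fps_compose_sub_distrib)
  have dM: "fps_deriv M = 48 * P + 24 * cubic_series" unfolding M_def N_def P_def by (rule cubic_series_ode)
  have 1: "clausen_arg * fps_deriv (cubic_series oo clausen_arg) = (P oo clausen_arg) * w"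
    using z0 by (simp add: fps_compose_deriv Pz w_def mult.assoc)
  have 3: "fps_deriv (clausen_arg * fps_deriv (cubic_series oo clausen_arg)) = (fps_deriv P oo clausen_arg) * (w * w) - 128 * (P oo clausen_arg)"
    unfolding 1 using z0 by (simp add: fps_compose_deriv dw mult.assoc flip: w_def)
  have 2: "clausen_arg * fps_deriv (clausen_arg * fps_deriv (cubic_series oo clausen_arg)) = M oo clausen_arg"
    unfolding 3 w2 Mz Nz by (simp add: algebra_simps)
  have "fps_deriv (M oo clausen_arg) = (48 * (P oo clausen_arg) + 24 * (cubic_series oo clausen_arg)) * w"
    using z0 by (simp add: fps_compose_deriv dM fps_compose_add_distrib fps_compose_mult_distrib flip: w_def)
  thus ?thesis unfolding 2 unfolding 1 w_def[symmetric] by (simp add: algebra_simps)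
qed

text \<open>The coefficient of \<open>x^n\<close> in the equation determines \<open>(n + 1)^3\<close> times the next coefficient
  of a solution from the previous ones.\<close>

lemma ode_unique:
  fixes Y Z :: "int fps"
  assumes Y: "fps_deriv (clausen_arg * fps_deriv (clausen_arg * fps_deriv Y)) = 48 * (clausen_arg * fps_deriv Y) + 24 * (fps_deriv clausen_arg * Y)"
    and Z: "fps_deriv (clausen_arg * fps_deriv (clausen_arg * fps_deriv Z)) = 48 * (clausen_arg * fps_deriv Z) + 24 * (fps_deriv clausen_arg * Z)"
    and 0: "Y $ 0 = Z $ 0"
  shows "Y = Z"
proof -
  define d where "d = Y - Z"
  have ode: "fps_deriv (clausen_arg * fps_deriv (clausen_arg * fps_deriv d)) = 48 * (clausen_arg * fps_deriv d) + 24 * (fps_deriv clausen_arg * d)"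
    using Y Z by (simp add: d_def algebra_simps)
  have "d $ n = 0" for n
  proof (induction n rule: less_induct)
    case (less n)
    show ?case
    proof (cases n)
      case 0 thus ?thesis using \<open>Y $ 0 = Z $ 0\<close> by (simp add: d_def)
    next
      case (Suc k)
      have d0: "d $ i = 0" if "i \<le> k" for i using less that Suc by simp
      have d1: "fps_deriv d $ i = 0" if "i < k" for i using d0 that by simp
      have d2: "fps_deriv (clausen_arg * fps_deriv d) $ i = 0" if "i < k" for i
        unfolding deriv_z_mult_nth using d1[OF that] d1[of "i - 1"] that
        by (simp del: fps_deriv_nth)
      have "fps_deriv (clausen_arg * fps_deriv (clausen_arg * fps_deriv d)) $ k = (int k + 1) * fps_deriv (clausen_arg * fps_deriv d) $ k"
        unfolding deriv_z_mult_nth[of "fps_deriv (clausen_arg * fps_deriv d)"] using d2[of "k - 1"] by (simp del: fps_deriv_nth fps_deriv_mult)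
      also have "fps_deriv (clausen_arg * fps_deriv d) $ k = (int k + 1) * fps_deriv d $ k"
        unfolding deriv_z_mult_nth using d1[of "k - 1"] by (simp del: fps_deriv_nth)
      finally have "fps_deriv (clausen_arg * fps_deriv (clausen_arg * fps_deriv d)) $ k = (int k + 1) * ((int k + 1) * ((int k + 1) * d $ Suc k))"
        by (simp del: fps_deriv_mult add: add.commute)
      moreover have "(clausen_arg * fps_deriv d) $ k = 0"
        using d1 by (cases k) (simp_all only: z_mult_nth z_mult_nth_0, simp del: fps_deriv_nth)
      moreover have "(fps_deriv clausen_arg * d) $ k = 0"
        unfolding fps_mult_nth using d0 by simp
      ultimately have "(int k + 1) * ((int k + 1) * ((int k + 1) * d $ Suc k)) = 0"
        unfolding ode by (simp add: numeral_fps_const)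
      thus ?thesis using Suc by simp
    qed
  qed
  thus ?thesis by (simp add: d_def fps_eq_iff)
qed

theorem clausen_square: "cubic_series oo clausen_arg = square_root_series ^ 2"
  by (rule ode_unique[OF cubic_compose_ode square_ode]) (simp add: square_root_series_def cubic_series_def acoeff_def bcoeff_def fps_power_zeroth)

lemma prime_power_dvd_fact: "p ^ j dvd fact (j * p)" if "p > 0" for p :: nat
proof (induction j)
  case (Suc j)
  \<comment> \<open>The factor \<open>(j + 1) p\<close> is split off from the factorial\<close>
  have "{Suc j * p} \<union> {1..j * p} \<subseteq> {1..Suc j * p}" using that by auto
  hence "prod id ({Suc j * p} \<union> {1..j * p}) dvd prod id {1..Suc j * p}" by (intro prod_dvd_prod_subset) auto
  moreover have "prod id ({Suc j * p} \<union> {1..j * p}) = Suc j * p * fact (j * p)"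
    using that by (subst prod.union_disjoint) (auto simp: fact_prod)
  ultimately have "Suc j * p * fact (j * p) dvd fact (Suc j * p)" by (simp add: fact_prod)
  moreover have "p * p ^ j dvd Suc j * p * fact (j * p)" using Suc by (intro mult_dvd_mono) auto
  ultimately show ?case by (metis dvd_trans power_Suc)
qed simp

lemma not_prime_square_dvd_fact:
  fixes p :: nat
  assumes p: "prime p" and n: "n < 2 * p"
  shows "\<not> p ^ 2 dvd fact n"
proof (cases "n < p")
  case True
  hence "\<not> p dvd fact n" using prime_dvd_fact_iff[OF p] by simp
  thus ?thesis by (metis dvd_mult_left power2_eq_square)
next
  case False
  have p1: "fact p = p * fact (p - 1)" using fact_reduce[of p, where 'a = nat] prime_gt_0_nat[OF p] by simp
  have "p dvd prod id {p<..n} \<Longrightarrow> False"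
  proof -
    assume "p dvd prod id {p<..n}"
    then obtain i where i: "i \<in> {p<..n}" "p dvd i" using prime_dvd_prod_iff[OF _ p, of "{p<..n}" id] by auto
    then obtain j where "i = p * j" by blast
    moreover have "1 < j" using i(1) calculation prime_gt_0_nat[OF p] by (cases j) auto
    ultimately have "2 * p \<le> i" by simp
    thus False using i n by simp
  qed
  moreover have "fact n = fact p * prod id {p<..n}"
  proof -
    have "{1..n} = {1..p} \<union> {p<..n}" using False by auto
    moreover have "prod id ({1..p} \<union> {p<..n}) = prod id {1..p} * prod id {p<..n}"
      by (intro prod.union_disjoint) auto
    ultimately show ?thesis by (simp add: fact_prod)
  qed
  moreover have "\<not> p dvd fact (p - 1)" using prime_dvd_fact_iff[OF p] prime_gt_0_nat[OF p] by simp
  ultimately have "\<not> p dvd fact (p - 1) * prod id {p<..n}" "fact n = p * (fact (p - 1) * prod id {p<..n})"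
    using prime_dvd_mult_iff[OF p] p1 by (blast, simp add: mult.assoc)
  thus ?thesis using prime_gt_0_nat[OF p] by (simp add: power2_eq_square)
qed

context
  fixes p :: nat
  assumes p: "prime p"
begin

lemma prime_dvd_choose: 
  assumes "n \<ge> p" "k < p" "n - k < p" "k \<le> n"
  shows "p dvd (n choose k)"
proof -
  have "fact k * fact (n - k) * (n choose k) = fact n" using assms by (intro binomial_fact_lemma)
  moreover have "p dvd fact n" using assms prime_dvd_fact_iff[OF p] by simp
  moreover have "\<not> p dvd fact k" "\<not> p dvd fact (n - k)" using assms prime_dvd_fact_iff[OF p] by simp_all
  ultimately show ?thesis using prime_dvd_mult_iff[OF p] by metis
qed

lemma p_dvd_central: "k < p \<Longrightarrow> p \<le> 2 * k \<Longrightarrow> int p dvd int ((2 * k) choose k)"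
  using prime_dvd_choose[of "2 * k" k] by simp

lemma p_dvd_quarter_1: "2 * k < p \<Longrightarrow> p \<le> 4 * k \<Longrightarrow> int p dvd int ((4 * k) choose (2 * k))"
  using prime_dvd_choose[of "4 * k" "2 * k"] by simp

text \<open>Here \<open>(4k)!\<close> contains at least three factors \<open>p\<close>, and \<open>(2k)!\<close> only one.\<close>

lemma p_dvd_quarter_3:
  assumes "k < p" "3 * p \<le> 4 * k"
  shows "int p dvd int ((4 * k) choose (2 * k))"
proof -
  have p0: "p > 0" using prime_gt_0_nat[OF p] .
  have "p dvd fact (2 * k)" using assms p0 prime_dvd_fact_iff[OF p] by simp
  then obtain u where u: "fact (2 * k) = p * u" by blast
  have "\<not> p ^ 2 dvd fact (2 * k)" using assms by (intro not_prime_square_dvd_fact p) simp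
  hence nu: "\<not> p dvd u" unfolding u power2_eq_square using p0 by simp
  have "p ^ 3 dvd fact (3 * p)" using prime_power_dvd_fact[OF p0] .
  also have "fact (3 * p) dvd (fact (4 * k) :: nat)" using assms by (intro fact_dvd) simp
  also have "fact (4 * k) = fact (2 * k) * fact (4 * k - 2 * k) * ((4 * k) choose (2 * k))"
    by (intro binomial_fact_lemma[symmetric]) simp
  also have "4 * k - 2 * k = 2 * k" by simp
  finally have "p ^ 2 * p dvd p ^ 2 * (u * u * ((4 * k) choose (2 * k)))"
    unfolding u by (simp add: power2_eq_square power3_eq_cube ac_simps)
  hence "p dvd u * u * ((4 * k) choose (2 * k))" using p0 by simp
  thus ?thesis using nu prime_dvd_mult_iff[OF p] by auto
qed

text \<open>The \<open>p\<close>-adic valuation of \<open>a\<^sub>k\<close> is at least \<open>1\<close> for \<open>p/4 < k < p\<close> and at least \<open>2\<close> for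
  \<open>3p/4 < k < p\<close>.\<close>

lemma acoeff_product_dvd:
  assumes "i < p" "j < p" "p \<le> i + j"
  shows "int p ^ 2 dvd acoeff i * acoeff j"
proof -
  have one: "int p dvd acoeff k" if "k < p" "p \<le> 4 * k" for k
    using p_dvd_central[of k] p_dvd_quarter_1[of k] that unfolding acoeff_def
    by (cases "2 * k < p") auto
  have two: "int p ^ 2 dvd acoeff k" if "k < p" "3 * p \<le> 4 * k" for k
    unfolding acoeff_def power2_eq_square using that
    by (intro mult_dvd_mono p_dvd_central p_dvd_quarter_3) auto
  consider "p \<le> 4 * i \<and> p \<le> 4 * j" | "3 * p \<le> 4 * i" | "3 * p \<le> 4 * j" using assms by linarith
  thus ?thesis
  proof cases
    case 1 thus ?thesis unfolding power2_eq_square using assms by (intro mult_dvd_mono one) auto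
  next
    case 2 thus ?thesis using two[of i] assms by simp
  next
    case 3 thus ?thesis using two[of j] assms by simp
  qed
qed

lemma bcoeff_dvd: "k < p \<Longrightarrow> p \<le> 2 * k \<Longrightarrow> int p ^ 2 dvd bcoeff k"
  unfolding bcoeff_def by (intro dvd_mult2 dvd_power_same p_dvd_central)

text \<open>Both sides are polynomials in \<open>x\<close>. Their coefficients below degree \<open>p\<close> agree by Clausen's formula,
  and the remaining ones are divisible by \<open>p^2\<close>.\<close>

theorem clausen_truncated:
  fixes x :: int
  shows "[(\<Sum>k<p. bcoeff k * (x * (1 - 64 * x)) ^ k) = (\<Sum>k<p. acoeff k * x ^ k) ^ 2] (mod int p ^ 2)"
proof -
  define zp :: "int poly" where "zp = [:0, 1, -64:]"
  define S where "S = (\<Sum>k<p. smult (bcoeff k) (zp ^ k))"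
  define T where "T = (\<Sum>k<p. monom (acoeff k) k)"
  have z_eq: "clausen_arg = fps_of_poly zp"
    by (simp add: clausen_arg_def zp_def fps_of_poly_pCons power2_eq_square algebra_simps numeral_fps_const)
  have z0: "clausen_arg $ 0 = 0" by (simp add: clausen_arg_def)
  have zk: "coeff (zp ^ k) n = (clausen_arg ^ k) $ n" for k n by (simp add: z_eq flip: fps_of_poly_power)
  have zk_low: "coeff (zp ^ k) n = 0" if "n < k" for k n
    using startsby_zero_power_prefix[OF z0, of k] that by (simp add: zk)
  have zk_high: "coeff (zp ^ k) n = 0" if "2 * k < n" for k n
  proof -
    have "degree (zp ^ k) \<le> degree zp * k" by (rule degree_power_le)
    thus ?thesis using that by (intro coeff_eq_0) (simp add: zp_def)
  qed
  have T: "coeff T i = (if i < p then acoeff i else 0)" for i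
    by (simp add: T_def coeff_sum)
  have "int p ^ 2 dvd coeff S n - coeff (T * T) n" for n
  proof (cases "n < p")
    case True
    have "coeff S n = (\<Sum>k<p. bcoeff k * coeff (zp ^ k) n)" by (simp add: S_def coeff_sum)
    also have "\<dots> = (\<Sum>k=0..n. bcoeff k * coeff (zp ^ k) n)"
      using True zk_low by (intro sum.mono_neutral_right) auto
    also have "\<dots> = (square_root_series ^ 2) $ n" by (simp add: zk cubic_series_def flip: clausen_square add: fps_compose_nth)
    also have "\<dots> = (\<Sum>i\<le>n. acoeff i * acoeff (n - i))"
      by (simp add: power2_eq_square fps_mult_nth square_root_series_def atMost_atLeast0)
    also have "\<dots> = coeff (T * T) n" unfolding coeff_mult using True by (intro sum.cong) (auto simp: T)
    finally show ?thesis by simp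
  next
    case False
    have "int p ^ 2 dvd coeff S n"
    proof -
      have "coeff S n = (\<Sum>k<p. bcoeff k * coeff (zp ^ k) n)" by (simp add: S_def coeff_sum)
      moreover have "int p ^ 2 dvd bcoeff k * coeff (zp ^ k) n" if "k < p" for k
        using bcoeff_dvd[OF that] zk_high[of k n] False by (cases "2 * k < n") auto
      ultimately show ?thesis by (auto intro!: dvd_sum)
    qed
    moreover have "int p ^ 2 dvd coeff (T * T) n"
      unfolding coeff_mult
    proof (rule dvd_sum)
      fix i assume "i \<in> {..n}"
      thus "int p ^ 2 dvd coeff T i * coeff T (n - i)"
        using acoeff_product_dvd[of i "n - i"] False by (auto simp: T)
    qed
    ultimately show ?thesis by (rule dvd_diff)
  qed
  hence "int p ^ 2 dvd poly (S - T * T) x"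
    unfolding poly_altdef by (intro dvd_sum dvd_mult2) simp
  moreover have "poly S x = (\<Sum>k<p. bcoeff k * (x * (1 - 64 * x)) ^ k)"
    by (simp add: S_def poly_sum zp_def algebra_simps)
  moreover have "poly T x = (\<Sum>k<p. acoeff k * x ^ k)" by (simp add: T_def poly_sum poly_monom)
  ultimately show ?thesis by (simp add: cong_iff_dvd_diff power2_eq_square)
qed

end

section \<open>Residues modulo an odd prime\<close>

text \<open>Residues modulo \<open>p\<close> are represented by integers, and functions on them by \<open>p\<close>-periodic functions
  on the integers.\<close>

locale odd_prime =
  fixes p :: nat
  assumes p_prime: "prime p" and p_odd: "odd p"
begin

text \<open>The exponent of Euler's criterion, the quadratic character, and the standard residues.\<close>

definition m :: nat where "m = (p - 1) div 2"

definition chi :: "int \<Rightarrow> int" where "chi a = Legendre a (int p)"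

definition R :: "int set" where "R = {0..<int p}"

lemma p_gt_2: "p > 2"
  using p_prime p_odd prime_gt_1_nat[of p] by (cases "p = 2") auto

lemma p_eq: "p = 2 * m + 1"
  using p_odd p_gt_2 by (auto simp: m_def)

lemma m_pos: "m > 0" using p_eq p_gt_2 by simp

lemma prime_int_p: "prime (int p)" using p_prime by simp

lemma not_dvd_small: "0 < a \<Longrightarrow> a < int p \<Longrightarrow> \<not> int p dvd a"
  using zdvd_not_zless by blast

lemma not_dvd_2: "\<not> int p dvd 2" using not_dvd_small[of 2] p_gt_2 by simp

lemma not_dvd_power2: "\<not> int p dvd 2 ^ k"
  using not_dvd_2 prime_dvd_power[OF prime_int_p] by blast

lemma not_dvd_mult: "\<not> int p dvd a \<Longrightarrow> \<not> int p dvd b \<Longrightarrow> \<not> int p dvd a * b"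
  using prime_dvd_mult_iff[OF prime_int_p] by blast

lemma cong_mult_cancel: "\<not> int p dvd c \<Longrightarrow> [c * a = c * b] (mod int p) \<Longrightarrow> [a = b] (mod int p)"
  using prime_dvd_mult_iff[OF prime_int_p, of c "a - b"]
  by (simp add: cong_iff_dvd_diff right_diff_distrib)

section \<open>The quadratic character\<close>

lemma chi_values: "chi a = 0 \<or> chi a = 1 \<or> chi a = -1"
  by (auto simp: chi_def Legendre_def)

lemma chi_eq_0_iff: "chi a = 0 \<longleftrightarrow> int p dvd a"
  by (auto simp: chi_def Legendre_def cong_0_iff)

lemma chi_cong:
  assumes "[a = b] (mod int p)"
  shows "chi a = chi b"
proof -
  have "[a = 0] (mod int p) \<longleftrightarrow> [b = 0] (mod int p)" using assms by (simp add: cong_def)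
  moreover have "QuadRes (int p) a \<longleftrightarrow> QuadRes (int p) b"
    unfolding QuadRes_def using assms by (simp add: cong_def)
  ultimately show ?thesis by (simp add: chi_def Legendre_def)
qed

lemma chi_euler: "[chi a = a ^ m] (mod int p)"
  using euler_criterion[OF p_prime p_gt_2, of a] by (simp add: chi_def m_def)

lemma sign_eqI:
  assumes "[a = b] (mod int p)" "\<bar>a\<bar> \<le> 1" "\<bar>b\<bar> \<le> 1"
  shows "a = b"
proof (rule ccontr)
  assume "a \<noteq> b"
  moreover have "int p dvd \<bar>a - b\<bar>" using assms(1) by (simp add: cong_iff_dvd_diff)
  ultimately show False using not_dvd_small[of "\<bar>a - b\<bar>"] assms(2,3) p_gt_2 by linarith
qed

lemma abs_chi: "\<bar>chi a\<bar> \<le> 1" using chi_values[of a] by auto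

lemma chi_mult: "chi (a * b) = chi a * chi b"
proof (rule sign_eqI)
  have "[chi (a * b) = a ^ m * b ^ m] (mod int p)" using chi_euler[of "a * b"] by (simp add: power_mult_distrib)
  also have "[a ^ m * b ^ m = chi a * chi b] (mod int p)"
    by (intro cong_mult cong_sym[OF chi_euler])
  finally show "[chi (a * b) = chi a * chi b] (mod int p)" .
  show "\<bar>chi a * chi b\<bar> \<le> 1" using chi_values[of a] chi_values[of b] by auto
qed (rule abs_chi)

lemma chi_1 [simp]: "chi 1 = 1"
  by (rule sign_eqI) (use chi_euler[of 1] abs_chi in auto)

lemma chi_0 [simp]: "chi 0 = 0" by (simp add: chi_eq_0_iff)

lemma chi_power: "chi (a ^ k) = chi a ^ k"
  by (induction k) (auto simp: chi_mult)

lemma chi_power_even: "\<not> int p dvd a \<Longrightarrow> even k \<Longrightarrow> chi (a ^ k) = 1"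
  using chi_values[of a] by (auto simp: chi_power chi_eq_0_iff)

lemma chi_square: "\<not> int p dvd a \<Longrightarrow> chi a * chi a = 1"
  using chi_values[of a] by (auto simp: chi_eq_0_iff)

lemma chi_times_square: "\<not> int p dvd a \<Longrightarrow> chi (a ^ 2 * b) = chi b"
  by (simp add: chi_mult chi_power_even)

lemma chi_eq_1D: "chi a = 1 \<Longrightarrow> \<exists>b. [b ^ 2 = a] (mod int p) \<and> \<not> int p dvd b"
proof -
  assume a: "chi a = 1"
  hence "QuadRes (int p) a" by (auto simp: chi_def Legendre_def split: if_splits)
  then obtain b where b: "[b ^ 2 = a] (mod int p)" by (auto simp: QuadRes_def)
  have "\<not> int p dvd b"
  proof
    assume "int p dvd b"
    hence "[0 = b ^ 2] (mod int p)" by (simp add: cong_iff_dvd_diff power2_eq_square)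
    hence "[0 = a] (mod int p)" using b by (rule cong_trans)
    hence "chi 0 = chi a" by (rule chi_cong)
    thus False using a by simp
  qed
  with b show ?thesis by blast
qed

section \<open>Inverses\<close>

text \<open>The inverse modulo \<open>p\<close> given by Fermat's theorem; \<open>recip 0\<close> is \<open>0\<close> modulo \<open>p\<close>.\<close>

definition recip :: "int \<Rightarrow> int" where "recip a = a ^ (p - 2)"

lemma recip: "\<not> int p dvd a \<Longrightarrow> [a * recip a = 1] (mod int p)"
proof -
  assume a: "\<not> int p dvd a"
  have "Suc (p - 2) = m + m" using p_eq m_pos by simp
  hence "a * recip a = a ^ m * a ^ m"
    unfolding recip_def by (simp only: power_Suc[symmetric] power_add[symmetric])
  also have "[a ^ m * a ^ m = chi a * chi a] (mod int p)" by (intro cong_mult cong_sym[OF chi_euler])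
  finally show ?thesis using chi_square[OF a] by simp
qed

lemma recip_nonzero: "\<not> int p dvd a \<Longrightarrow> \<not> int p dvd recip a"
  using prime_dvd_power[OF prime_int_p] by (auto simp: recip_def)

section \<open>Sums over the residues\<close>

text \<open>Periodicity modulo \<open>p\<close>.\<close>

definition per :: "(int \<Rightarrow> 'b) \<Rightarrow> bool" where
  "per F \<longleftrightarrow> (\<forall>a b. [a = b] (mod int p) \<longrightarrow> F a = F b)"

lemma perD: "per F \<Longrightarrow> [a = b] (mod int p) \<Longrightarrow> F a = F b" by (auto simp: per_def)

lemma finite_R [simp]: "finite R" by (simp add: R_def)
lemma card_R [simp]: "card R = p" by (simp add: R_def)
lemma zero_in_R [simp]: "0 \<in> R" using p_gt_2 by (simp add: R_def)

lemma mod_in_R [simp]: "a mod int p \<in> R" using p_gt_2 by (simp add: R_def)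

lemma R_inj: "a \<in> R \<Longrightarrow> b \<in> R \<Longrightarrow> [a = b] (mod int p) \<Longrightarrow> a = b"
  by (auto simp: R_def cong_def)

lemma R_cong_iff: "a \<in> R \<Longrightarrow> [a = b] (mod int p) \<longleftrightarrow> a = b mod int p"
  by (simp add: R_def cong_def)

lemma R_dvd: "a \<in> R \<Longrightarrow> int p dvd a \<longleftrightarrow> a = 0"
  using R_inj[of a 0] by (auto simp: cong_0_iff)

lemma sum_subst:
  fixes F :: "int \<Rightarrow> 'b :: comm_monoid_add"
  assumes F: "per F" and f: "\<And>x y. x \<in> R \<Longrightarrow> y \<in> R \<Longrightarrow> [f x = f y] (mod int p) \<Longrightarrow> x = y"
  shows "(\<Sum>x\<in>R. F (f x)) = (\<Sum>x\<in>R. F x)"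
proof -
  let ?g = "\<lambda>x. f x mod int p"
  have inj: "inj_on ?g R" by (rule inj_onI, rule f) (simp_all add: cong_def)
  hence "?g ` R = R" by (intro endo_inj_surj) auto
  hence "(\<Sum>x\<in>R. F x) = (\<Sum>x\<in>R. F (?g x))" using sum.reindex[OF inj, of F] by simp
  also have "\<dots> = (\<Sum>x\<in>R. F (f x))" by (intro sum.cong perD[OF F]) auto
  finally show ?thesis by simp
qed

lemma sum_affine:
  fixes F :: "int \<Rightarrow> 'b :: comm_monoid_add"
  assumes "per F" "\<not> int p dvd a"
  shows "(\<Sum>x\<in>R. F (a * x + b)) = (\<Sum>x\<in>R. F x)"
proof (rule sum_subst[OF assms(1)])
  fix x y assume xy: "x \<in> R" "y \<in> R" "[a * x + b = a * y + b] (mod int p)"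
  hence "[a * x = a * y] (mod int p)" by (simp add: cong_iff_dvd_diff)
  thus "x = y" using xy cong_mult_cancel[OF assms(2)] R_inj by blast
qed

lemma sum_reflect: "per F \<Longrightarrow> (\<Sum>x\<in>R. F (- x)) = (\<Sum>x\<in>R. F (x :: int) :: 'b :: comm_monoid_add)"
  using sum_affine[of F "-1" 0] p_gt_2 by simp

lemma sum_inverse:
  fixes F :: "int \<Rightarrow> 'b :: comm_monoid_add"
  assumes F: "per F"
  shows "(\<Sum>x\<in>R-{0}. F (recip x)) = (\<Sum>x\<in>R-{0}. F x)"
proof -
  let ?g = "\<lambda>x. recip x mod int p"
  have nz: "\<not> int p dvd x" if "x \<in> R - {0}" for x using that R_dvd by auto
  have inj: "inj_on ?g (R - {0})"
  proof (rule inj_onI)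
    fix x y assume xy: "x \<in> R - {0}" "y \<in> R - {0}" "?g x = ?g y"
    hence "[recip x = recip y] (mod int p)" by (simp add: cong_def)
    hence "[x * (y * recip y) = y * (x * recip x)] (mod int p)"
      using cong_mult[OF cong_refl[of "x * y"], of "recip y" "recip x" "int p"] by (simp add: ac_simps cong_sym)
    moreover have "[x * 1 = x * (y * recip y)] (mod int p)" "[y * (x * recip x) = y * 1] (mod int p)"
      using xy(1,2)[THEN nz] by (intro cong_mult cong_refl recip cong_sym[OF recip]; simp)+
    ultimately have "[x = y] (mod int p)" by (simp add: cong_def)
    thus "x = y" using xy R_inj by auto
  qed
  moreover have "?g ` (R - {0}) \<subseteq> R - {0}"
    using recip_nonzero nz by (auto simp flip: dvd_eq_mod_eq_0)
  ultimately have "?g ` (R - {0}) = R - {0}" by (intro endo_inj_surj) auto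
  hence "(\<Sum>x\<in>R-{0}. F x) = (\<Sum>x\<in>R-{0}. F (?g x))" using sum.reindex[OF inj, of F] by simp
  also have "\<dots> = (\<Sum>x\<in>R-{0}. F (recip x))" by (intro sum.cong perD[OF F]) auto
  finally show ?thesis by simp
qed

lemma card_square_roots: "int (card {z\<in>R. [z ^ 2 = d] (mod int p)}) = 1 + chi d"
proof -
  consider "int p dvd d" | "chi d = -1" | "chi d = 1" using chi_values[of d] chi_eq_0_iff by auto
  thus ?thesis
  proof cases
    case 1
    hence "[z ^ 2 = d] (mod int p) \<longleftrightarrow> int p dvd z" for z
      using prime_dvd_power_iff[OF prime_int_p, of 2 z] by (simp add: cong_def mod_eq_0_iff_dvd)
    hence "{z\<in>R. [z ^ 2 = d] (mod int p)} = {0}" using R_dvd by auto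
    thus ?thesis using 1 chi_eq_0_iff by simp
  next
    case 2
    have "\<not> [z ^ 2 = d] (mod int p)" for z
      using 2 chi_cong[of "z ^ 2" d] chi_power[of z 2] zero_le_power2[of "chi z"] by auto
    thus ?thesis using 2 by simp
  next
    case 3
    then obtain b where b: "[b ^ 2 = d] (mod int p)" "\<not> int p dvd b" using chi_eq_1D by blast
    have "[z ^ 2 = d] (mod int p) \<longleftrightarrow> [z = b] (mod int p) \<or> [z = - b] (mod int p)" for z
    proof -
      have "[z ^ 2 = d] (mod int p) \<longleftrightarrow> [z ^ 2 = b ^ 2] (mod int p)" using b(1) by (simp add: cong_def)
      also have "\<dots> \<longleftrightarrow> int p dvd (z - b) * (z + b)"
        by (simp add: cong_iff_dvd_diff power2_eq_square algebra_simps)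
      also have "\<dots> \<longleftrightarrow> [z = b] (mod int p) \<or> [z = - b] (mod int p)"
        using prime_dvd_mult_iff[OF prime_int_p] by (simp add: cong_iff_dvd_diff)
      finally show ?thesis .
    qed
    hence "{z\<in>R. [z ^ 2 = d] (mod int p)} = {z\<in>R. z = b mod int p \<or> z = (- b) mod int p}"
      using R_cong_iff by (intro Collect_cong) blast
    also have "\<dots> = {b mod int p, (- b) mod int p}" by auto
    finally have "{z\<in>R. [z ^ 2 = d] (mod int p)} = {b mod int p, (- b) mod int p}" .
    moreover have "b mod int p \<noteq> (- b) mod int p"
    proof
      assume "b mod int p = (- b) mod int p"
      hence "int p dvd 2 * b" by (simp add: mod_eq_dvd_iff)
      thus False using not_dvd_mult[OF not_dvd_2 b(2)] by simp
    qed
    ultimately show ?thesis using 3 by simp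
  qed
qed

lemma sum_squares_count:
  assumes "per F"
  shows "(\<Sum>z\<in>R. F (z ^ 2)) = (\<Sum>d\<in>R. (1 + chi d) * (F d :: int))"
proof -
  have "(\<Sum>z\<in>R. F (z ^ 2)) = (\<Sum>z\<in>R. \<Sum>d\<in>R. if d = z ^ 2 mod int p then F d else 0)"
    using assms by (auto simp: perD intro!: sum.cong)
  also have "\<dots> = (\<Sum>d\<in>R. \<Sum>z\<in>R. if d = z ^ 2 mod int p then F d else 0)" by (rule sum.swap)
  also have "\<dots> = (\<Sum>d\<in>R. (1 + chi d) * F d)"
  proof (rule sum.cong[OF refl])
    fix d assume d: "d \<in> R"
    hence "{z\<in>R. [z ^ 2 = d] (mod int p)} = {z\<in>R. d = z ^ 2 mod int p}"
      by (auto simp: cong_def R_def)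
    hence card: "int (card {z\<in>R. d = z ^ 2 mod int p}) = 1 + chi d"
      using card_square_roots[of d] by simp
    have "(\<Sum>z\<in>R. if d = z ^ 2 mod int p then F d else 0)
        = (\<Sum>z\<in>{z\<in>R. d = z ^ 2 mod int p}. F d)"
      by (rule sum.inter_filter[symmetric]) simp
    also have "\<dots> = int (card {z\<in>R. d = z ^ 2 mod int p}) * F d" by (rule sum_constant)
    finally show "(\<Sum>z\<in>R. if d = z ^ 2 mod int p then F d else 0) = (1 + chi d) * F d"
      unfolding card .
  qed
  finally show ?thesis .
qed

lemma per_chi: "(\<And>a b. [a = b] (mod int p) \<Longrightarrow> [f a = f b] (mod int p)) \<Longrightarrow> per (\<lambda>a. chi (f a))"
  by (auto simp: per_def intro: chi_cong)

lemma sum_chi: "(\<Sum>x\<in>R. chi x) = 0"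
  using sum_squares_count[of "\<lambda>_. 1"] by (simp add: per_def sum.distrib)

lemma sum_chi_affine: "\<not> int p dvd a \<Longrightarrow> (\<Sum>x\<in>R. chi (a * x + b)) = 0"
  using sum_affine[of chi a b] sum_chi per_chi[of "\<lambda>x. x"] by simp

text \<open>The least positive nonresidue is one more than a square modulo \<open>p\<close>.\<close>

lemma ex_nonresidue_sum_two_squares: "\<exists>a. chi (a ^ 2 + 1) = -1"
proof -
  have "\<exists>n::nat. chi (int n) = -1"
  proof (rule ccontr)
    assume "\<not> ?thesis"
    hence "chi x \<ge> 0" if "x \<in> R" for x
      using chi_values[of x] that by (auto simp: R_def dest: nonneg_int_cases)
    moreover have "1 \<in> R" using p_gt_2 by (simp add: R_def)
    ultimately have "chi 1 \<le> (\<Sum>x\<in>R. chi x)" by (intro member_le_sum) auto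
    thus False by (simp add: sum_chi)
  qed
  define n where "n = (LEAST n. chi (int n) = -1)"
  have n: "chi (int n) = -1" using \<open>\<exists>n. _ n\<close> unfolding n_def by (rule LeastI_ex)
  hence "n \<noteq> 0" by (metis chi_0 of_nat_0 zero_neq_neg_one)
  hence "chi (int (n - 1)) \<noteq> -1" using not_less_Least[of "n - 1" "\<lambda>n. chi (int n) = -1"] by (simp add: n_def)
  then consider "chi (int (n - 1)) = 1" | "int p dvd int (n - 1)" using chi_values chi_eq_0_iff by blast
  thus ?thesis
  proof cases
    case 1
    then obtain b where "[b ^ 2 = int (n - 1)] (mod int p)" using chi_eq_1D by blast
    hence "[b ^ 2 + 1 = int (n - 1) + 1] (mod int p)" by (intro cong_add) auto
    hence "chi (b ^ 2 + 1) = chi (int n)" using chi_cong \<open>n \<noteq> 0\<close> by (simp add: of_nat_diff)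
    thus ?thesis using n by auto
  next
    case 2
    hence "[int n = 1] (mod int p)" using \<open>n \<noteq> 0\<close> by (simp add: cong_iff_dvd_diff of_nat_diff)
    hence "chi (int n) = 1" using chi_cong chi_1 by metis
    thus ?thesis using n by simp
  qed
qed

section \<open>Power sums\<close>

lemma per_power_mod: "per (\<lambda>x. x ^ k mod int p)"
  unfolding per_def using cong_pow unfolding cong_def by blast

lemma sum_powers_cong_0:
  assumes "\<not> (p - 1) dvd k"
  shows "[(\<Sum>x\<in>R. x ^ k) = 0] (mod int p)"
proof -
  obtain g where g: "residue_primroot p g" using prime_primitive_root_exists[of p] p_prime prime_gt_1_nat by auto
  have ord: "ord p g = p - 1" and cop: "coprime p g" using g totient_prime[OF p_prime] by (auto simp: residue_primroot_def)
  have ng: "\<not> int p dvd int g" 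
  proof
    assume "int p dvd int g"
    hence "p dvd g" by simp
    hence "p dvd 1" using cop coprime_common_divisor[of p g p] by simp
    thus False using p_gt_2 by simp
  qed
  have "\<not> [g ^ k = 1] (mod p)" using assms ord ord_divides[of g k p] by simp
  hence "\<not> [int g ^ k = 1] (mod int p)" by (metis cong_int_iff of_nat_1 of_nat_power)
  hence 1: "\<not> int p dvd 1 - int g ^ k" by (simp add: cong_iff_dvd_diff dvd_diff_commute)
  have "(\<Sum>x\<in>R. x ^ k mod int p) = (\<Sum>x\<in>R. (int g * x + 0) ^ k mod int p)"
    by (rule sum_affine[OF _ ng, symmetric])(rule per_power_mod)
  hence "[(\<Sum>x\<in>R. x ^ k) = (\<Sum>x\<in>R. (int g * x) ^ k)] (mod int p)"
    unfolding cong_def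
    using mod_sum_eq[of "\<lambda>x. x ^ k" "int p" R] mod_sum_eq[of "\<lambda>x. (int g * x) ^ k" "int p" R] by simp
  hence "[(\<Sum>x\<in>R. x ^ k) = int g ^ k * (\<Sum>x\<in>R. x ^ k)] (mod int p)"
    by (simp add: power_mult_distrib sum_distrib_left)
  hence "int p dvd (1 - int g ^ k) * (\<Sum>x\<in>R. x ^ k)" by (simp add: cong_iff_dvd_diff left_diff_distrib)
  thus ?thesis using 1 prime_dvd_mult_iff[OF prime_int_p] by (auto simp: cong_0_iff)
qed

lemma sum_powers_p_minus_1: "[(\<Sum>x\<in>R. x ^ (p - 1)) = -1] (mod int p)"
proof -
  have "[(\<Sum>x\<in>R. x ^ (p - 1)) = (\<Sum>x\<in>R. if x = 0 then 0 else 1)] (mod int p)"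
  proof (rule cong_sum)
    fix x assume x: "x \<in> R"
    have "[x ^ (p - 1) = chi x * chi x] (mod int p)"
    proof -
      have "p - 1 = m + m" using p_eq by simp
      thus ?thesis using cong_sym[OF cong_mult[OF chi_euler chi_euler, of x x]] by (simp only: power_add)
    qed
    moreover have "chi x * chi x = (if x = 0 then 0 else 1)" using chi_square x R_dvd by auto
    ultimately show "[x ^ (p - 1) = (if x = 0 then 0 else 1)] (mod int p)" by simp
  qed
  also have "(\<Sum>x\<in>R. if x = 0 then 0 else 1) = (\<Sum>x\<in>R. 1) - (\<Sum>x\<in>R. if x = 0 then (1::int) else 0)"
    by (subst sum_subtractf[symmetric]) (intro sum.cong, auto)
  also have "\<dots> = int p - 1" by simp
  also have "[int p - 1 = -1] (mod int p)" by (simp add: cong_iff_dvd_diff)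
  finally show ?thesis .
qed

text \<open>Up to sign, summing over all residues extracts the coefficient of degree \<open>p - 1\<close>.\<close>

lemma sum_poly_cong:
  assumes "degree P < 2 * (p - 1)"
  shows "[(\<Sum>x\<in>R. poly P x) = - coeff P (p - 1)] (mod int p)"
proof -
  have "(\<Sum>x\<in>R. poly P x) = (\<Sum>i\<le>degree P. coeff P i * (\<Sum>x\<in>R. x ^ i))"
    by (simp add: poly_altdef sum_distrib_left) (rule sum.swap)
  also have "[\<dots> = (\<Sum>i\<le>degree P. if i = p - 1 then - coeff P i else 0)] (mod int p)"
  proof (rule cong_sum)
    fix i assume i: "i \<in> {..degree P}"
    consider "i = 0" | "i = p - 1" | "\<not> (p - 1) dvd i"
    proof -
      have "i < 2 * (p - 1)" using i assms by simp
      moreover have "i = 0 \<or> i = p - 1" if "i < 2 * (p - 1)" "(p - 1) dvd i"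
      proof -
        from that(2) obtain j where j: "i = (p - 1) * j" ..
        hence "(p - 1) * j < (p - 1) * 2" using that(1) by simp
        hence "j < 2" by simp
        thus ?thesis using j by (cases j) auto
      qed
      ultimately show ?thesis using that by blast
    qed
    thus "[coeff P i * (\<Sum>x\<in>R. x ^ i) = (if i = p - 1 then - coeff P i else 0)] (mod int p)"
    proof cases
      case 1 thus ?thesis using p_gt_2 by (simp add: cong_0_iff)
    next
      case 2 thus ?thesis using cong_mult[OF cong_refl[of "coeff P i"] sum_powers_p_minus_1] by simp
    next
      case 3
      hence "i \<noteq> p - 1" by auto
      thus ?thesis using cong_mult[OF cong_refl[of "coeff P i"] sum_powers_cong_0[OF 3]] by simp
    qed
  qed
  also have "(\<Sum>i\<le>degree P. if i = p - 1 then - coeff P i else 0) = - coeff P (p - 1)"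
    by (auto simp: coeff_eq_0)
  finally show ?thesis .
qed

section \<open>The cubic character sum\<close>

lemmas per_intros = per_chi cong_mult cong_add cong_diff cong_pow cong_refl

lemma sum_R_split: "(\<Sum>x\<in>R. F x) = F 0 + (\<Sum>x\<in>R-{0}. F x)" for F :: "int \<Rightarrow> int"
  by (simp add: sum.remove)

lemma nz: "x \<in> R - {0} \<Longrightarrow> \<not> int p dvd x"
  using R_dvd by auto

lemma chi_eq_cancel:
  assumes "\<not> int p dvd a" "even k" "[a ^ k * x = y] (mod int p)"
  shows "chi x = chi y"
proof -
  have "chi y = chi (a ^ k * x)" by (rule chi_cong[OF cong_sym[OF assms(3)]])
  thus ?thesis using chi_power_even[OF assms(1,2)] by (simp add: chi_mult)
qed

text \<open>Minus the trace of Frobenius of the curve \<open>Y^2 = X^3 + 4 X^2 + 2 X\<close>.\<close>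

definition cubic_sum :: int where "cubic_sum = (\<Sum>y\<in>R. chi (y * (y ^ 2 + 4 * y + 2)))"

lemma cubic_sum_cong: "[cubic_sum = - coeff ([:2, 4, 1:] ^ m) m] (mod int p)"
proof -
  let ?P = "[:0, 2, 4, 1 :: int:]"
  have deg: "degree (?P ^ m) < 2 * (p - 1)"
  proof -
    have "degree (?P ^ m) \<le> 3 * m" using degree_power_le[of ?P m] by simp
    thus ?thesis using p_eq m_pos by linarith
  qed
  have "?P = monom 1 1 * [:2, 4, 1:]" by (simp add: monom_altdef)
  hence "?P ^ m = monom 1 m * [:2, 4, 1:] ^ m" by (simp only: power_mult_distrib monom_power) simp
  moreover have "p - 1 = m + m" using p_eq by simp
  ultimately have c: "coeff (?P ^ m) (p - 1) = coeff ([:2, 4, 1:] ^ m) m"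
    by (simp add: coeff_monom_mult)
  have "[cubic_sum = (\<Sum>y\<in>R. poly (?P ^ m) y)] (mod int p)"
    unfolding cubic_sum_def
  proof (rule cong_sum)
    fix y
    have "poly (?P ^ m) y = (y * (y ^ 2 + 4 * y + 2)) ^ m"
      by (simp add: poly_power algebra_simps power2_eq_square)
    thus "[chi (y * (y ^ 2 + 4 * y + 2)) = poly (?P ^ m) y] (mod int p)" using chi_euler by simp
  qed
  also have "[(\<Sum>y\<in>R. poly (?P ^ m) y) = - coeff (?P ^ m) (p - 1)] (mod int p)"
    by (rule sum_poly_cong[OF deg])
  finally show ?thesis unfolding c .
qed

text \<open>The equation \<open>y + c / y = w\<close> is quadratic in \<open>y\<close> with discriminant \<open>w^2 - 4 c\<close>.\<close>

lemma sum_plus_recip: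
  assumes F: "per F" and c: "\<not> int p dvd c"
  shows "(\<Sum>y\<in>R-{0}. F (y + c * recip y)) = (\<Sum>w\<in>R. (1 + chi (w ^ 2 - 4 * c)) * (F w :: int))"
proof -
  have "(\<Sum>y\<in>R-{0}. F (y + c * recip y))
      = (\<Sum>y\<in>R-{0}. \<Sum>w\<in>R. if w = (y + c * recip y) mod int p then F w else 0)"
  proof (rule sum.cong[OF refl])
    fix y
    show "F (y + c * recip y) = (\<Sum>w\<in>R. if w = (y + c * recip y) mod int p then F w else 0)"
      using perD[OF F, of "(y + c * recip y) mod int p" "y + c * recip y"] by simp
  qed
  also have "\<dots> = (\<Sum>w\<in>R. \<Sum>y\<in>R-{0}. if w = (y + c * recip y) mod int p then F w else 0)"
    by (rule sum.swap)
  also have "\<dots> = (\<Sum>w\<in>R. (1 + chi (w ^ 2 - 4 * c)) * F w)"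
  proof (rule sum.cong[OF refl])
    fix w assume w: "w \<in> R"
    let ?d = "w ^ 2 - 4 * c"
    let ?I = "\<lambda>z. if [z ^ 2 = ?d] (mod int p) then 1 else (0 :: int)"
    have iff: "w = (y + c * recip y) mod int p \<longleftrightarrow> [(2 * y + - w) ^ 2 = ?d] (mod int p)"
      if y: "y \<in> R - {0}" for y
    proof -
      have "w = (y + c * recip y) mod int p \<longleftrightarrow> [w = y + c * recip y] (mod int p)"
        by (rule R_cong_iff[OF w, symmetric])
      also have "\<dots> \<longleftrightarrow> int p dvd (4 * y) * (y + c * recip y - w)"
        using prime_dvd_mult_iff[OF prime_int_p] not_dvd_power2[of 2] nz[OF y]
        by (simp add: cong_iff_dvd_diff dvd_diff_commute)
      also have "(4 * y) * (y + c * recip y - w) = ((2 * y + - w) ^ 2 - ?d) + 4 * c * (y * recip y - 1)"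
        by (simp add: power2_eq_square algebra_simps)
      also have "int p dvd \<dots> \<longleftrightarrow> int p dvd (2 * y + - w) ^ 2 - ?d"
        using recip[OF nz[OF y]] by (intro dvd_add_left_iff dvd_mult) (simp add: cong_iff_dvd_diff)
      finally show ?thesis by (simp add: cong_iff_dvd_diff)
    qed
    have "(\<Sum>y\<in>R-{0}. if w = (y + c * recip y) mod int p then F w else 0)
        = (\<Sum>y\<in>R-{0}. ?I (2 * y + - w)) * F w"
      unfolding sum_distrib_right by (rule sum.cong[OF refl]) (simp add: iff)
    also have "(\<Sum>y\<in>R-{0}. ?I (2 * y + - w)) = (\<Sum>y\<in>R. ?I (2 * y + - w))"
    proof -
      have "\<not> int p dvd 4 * c" using not_dvd_mult[OF not_dvd_power2[of 2] c] by simp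
      hence "?I (2 * 0 + - w) = 0" by (simp add: cong_iff_dvd_diff)
      thus ?thesis by (simp only: sum_R_split)
    qed
    also have "\<dots> = (\<Sum>z\<in>R. ?I z)"
      by (rule sum_affine[OF _ not_dvd_2])
         (auto simp: per_def cong_def dest: cong_pow[unfolded cong_def, of _ _ _ 2])
    also have "\<dots> = (\<Sum>z\<in>{z\<in>R. [z ^ 2 = ?d] (mod int p)}. 1)" by (rule sum.inter_filter[symmetric]) simp
    also have "\<dots> = 1 + chi ?d" using card_square_roots[of ?d] by simp
    finally show "(\<Sum>y\<in>R-{0}. if w = (y + c * recip y) mod int p then F w else 0) = (1 + chi ?d) * F w" .
  qed
  finally show ?thesis .
qed

text \<open>The substitution \<open>w = y + 2 / y\<close> is the 2-isogeny of the curve with kernel generated by the origin.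
  Its image is the twist of the curve by \<open>-2\<close>, as \<open>w = -2 (v + 2)\<close> shows.\<close>

lemma cubic_sum_twist: "cubic_sum = chi (-2) * cubic_sum"
proof -
  have "cubic_sum = (\<Sum>y\<in>R-{0}. chi (y * (y ^ 2 + 4 * y + 2)))" by (simp add: cubic_sum_def sum_R_split)
  also have "\<dots> = (\<Sum>y\<in>R-{0}. chi (y + 2 * recip y + 4))"
  proof (rule sum.cong[OF refl])
    fix y assume y: "y \<in> R - {0}"
    have "y ^ 2 * (y + 2 * recip y + 4) - y * (y ^ 2 + 4 * y + 2) = 2 * y * (y * recip y - 1)"
      by (simp add: power2_eq_square algebra_simps)
    hence "[y ^ 2 * (y + 2 * recip y + 4) = y * (y ^ 2 + 4 * y + 2)] (mod int p)"
      using recip[OF nz[OF y]] by (simp add: cong_iff_dvd_diff)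
    thus "chi (y * (y ^ 2 + 4 * y + 2)) = chi (y + 2 * recip y + 4)"
      using chi_eq_cancel[OF nz[OF y], of 2] by simp
  qed
  also have "\<dots> = (\<Sum>w\<in>R. (1 + chi (w ^ 2 - 4 * 2)) * chi (w + 4))"
    by (rule sum_plus_recip[OF _ not_dvd_2]) (auto intro!: per_intros)
  also have "\<dots> = (\<Sum>w\<in>R. chi (1 * w + 4)) + (\<Sum>w\<in>R. chi ((w ^ 2 - 8) * (w + 4)))"
    by (simp add: chi_mult distrib_right sum.distrib)
  also have "(\<Sum>w\<in>R. chi (1 * w + 4)) = 0" using p_gt_2 by (intro sum_chi_affine) simp
  also have "(\<Sum>w\<in>R. chi ((w ^ 2 - 8) * (w + 4)))
      = (\<Sum>y\<in>R. chi ((((-2) * y + (-4)) ^ 2 - 8) * (((-2) * y + (-4)) + 4)))"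
    using not_dvd_2 by (intro sum_affine[symmetric]) (auto intro!: per_intros)
  also have "\<dots> = (\<Sum>y\<in>R. chi (-2) * chi (y * (y ^ 2 + 4 * y + 2)))"
  proof (rule sum.cong[OF refl])
    fix y :: int
    have "(((-2) * y + (-4)) ^ 2 - 8) * (((-2) * y + (-4)) + 4) = 2 ^ 2 * ((-2) * (y * (y ^ 2 + 4 * y + 2)))"
      by (simp add: power2_eq_square algebra_simps)
    thus "chi ((((-2) * y + (-4)) ^ 2 - 8) * (((-2) * y + (-4)) + 4)) = chi (-2) * chi (y * (y ^ 2 + 4 * y + 2))"
      by (simp only: chi_times_square[OF not_dvd_2] chi_mult[of "-2"])
  qed
  also have "0 + \<dots> = chi (-2) * cubic_sum" by (simp add: cubic_sum_def sum_distrib_left)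
  finally show ?thesis .
qed

text \<open>The curve \<open>Y^2 = (t^2 + 1) (t^4 - 6 t^2 + 1)\<close> of genus two covers the elliptic curve by means of
  \<open>w = t + 1 / t\<close>. A nonzero \<open>t\<close> other than \<open>-1\<close> has the same character as \<open>w + 2\<close>, since
  \<open>t (w + 2) = (t + 1)^2\<close>.\<close>

lemma sextic_sum:
  assumes chi_neg2: "chi (-2) = 1"
  shows "1 + (\<Sum>t\<in>R. chi ((t ^ 2 + 1) * (t ^ 4 - 6 * t ^ 2 + 1))) = 2 * cubic_sum"
proof -
  let ?g = "\<lambda>t::int. (t ^ 2 + 1) * (t ^ 4 - 6 * t ^ 2 + 1)"
  let ?F = "\<lambda>w. chi ((w + 2) * (w * (w ^ 2 - 8)))"
  have per_F: "per ?F" by (auto intro!: per_intros)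
  have chi_8: "chi (-8) = 1" "chi (-32) = 1"
    using chi_times_square[OF not_dvd_2, of "-2"] chi_neg2 chi_times_square[OF not_dvd_power2[of 2], of "-2"] by simp_all
  have m1: "int p - 1 \<in> R - {0}" "[int p - 1 = -1] (mod int p)"
    using p_gt_2 by (auto simp: R_def cong_iff_dvd_diff)
  have m1_iff: "t = int p - 1" if "t \<in> R" "int p dvd t + 1" for t
    using R_inj[of t "int p - 1"] m1 that by (auto simp: cong_def mod_eq_dvd_iff intro!: dvd_diff)
  have "(\<Sum>t\<in>R-{0}. chi (?g t)) = (\<Sum>t\<in>R-{0}. ?F (t + 1 * recip t) + (if t = int p - 1 then 1 else 0))"
  proof (rule sum.cong[OF refl])
    fix t assume t: "t \<in> R - {0}"
    define w where "w = t + recip t"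
    have tr: "int p dvd t * recip t - 1" using recip[OF nz[OF t]] by (simp add: cong_iff_dvd_diff)
    have w1: "[t * w = t ^ 2 + 1] (mod int p)"
      using tr by (simp add: w_def cong_iff_dvd_diff power2_eq_square algebra_simps)
    have w2: "[t ^ 2 * (w ^ 2 - 8) = t ^ 4 - 6 * t ^ 2 + 1] (mod int p)"
    proof -
      have "t ^ 2 * (w ^ 2 - 8) = (t * w) ^ 2 - 8 * t ^ 2" by (simp add: power2_eq_square algebra_simps)
      also have "[\<dots> = (t ^ 2 + 1) ^ 2 - 8 * t ^ 2] (mod int p)" using w1 by (intro cong_diff cong_pow cong_refl)
      also have "(t ^ 2 + 1) ^ 2 - 8 * t ^ 2 = t ^ 4 - 6 * t ^ 2 + 1" by (simp add: power2_eq_square power4_eq_xxxx algebra_simps)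
      finally show ?thesis .
    qed
    have "[(t * w) * (t ^ 2 * (w ^ 2 - 8)) = ?g t] (mod int p)" by (intro cong_mult w1 w2)
    hence "chi (?g t) = chi ((t * w) * (t ^ 2 * (w ^ 2 - 8)))" by (rule chi_cong[OF cong_sym])
    also have "(t * w) * (t ^ 2 * (w ^ 2 - 8)) = t ^ 2 * (t * (w * (w ^ 2 - 8)))" by (simp add: algebra_simps)
    also have "chi \<dots> = chi t * chi (w * (w ^ 2 - 8))" by (simp only: chi_times_square[OF nz[OF t]] chi_mult[of t])
    finally have g: "chi (?g t) = chi t * chi (w * (w ^ 2 - 8))" .
    have w3: "[t * (w + 2) = (t + 1) ^ 2] (mod int p)"
      using cong_add[OF w1 cong_refl[of "2 * t"]] by (simp add: power2_eq_square algebra_simps)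
    hence w4: "chi t * chi (w + 2) = chi (t + 1) ^ 2" using chi_cong[OF w3] by (simp add: chi_mult chi_power)
    show "chi (?g t) = ?F (t + 1 * recip t) + (if t = int p - 1 then 1 else 0)"
    proof (cases "int p dvd t + 1")
      case True
      hence t1: "t = int p - 1" using m1_iff t by blast
      have "?F w = 0" using w4 nz[OF t] True by (auto simp: chi_mult chi_eq_0_iff[symmetric])
      moreover have "chi (?g t) = chi (?g (-1))"
        using m1(2) unfolding t1 by (intro chi_cong cong_mult cong_add cong_diff cong_pow cong_refl)
      moreover have "chi (?g (-1)) = 1" using chi_8 by simp
      ultimately show ?thesis using t1 by (simp add: w_def)
    next
      case False
      hence "t \<noteq> int p - 1" by auto
      moreover have "chi t * chi (w + 2) = 1" using w4 chi_square[OF False] by (simp add: power2_eq_square)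
      hence "chi t = chi (w + 2)" using chi_values[of t] chi_values[of "w + 2"] by auto
      ultimately show ?thesis using g by (simp add: w_def chi_mult)
    qed
  qed
  also have "\<dots> = (\<Sum>t\<in>R-{0}. ?F (t + 1 * recip t)) + 1"
    using m1(1) by (simp add: sum.distrib)
  also have "(\<Sum>t\<in>R-{0}. ?F (t + 1 * recip t)) = (\<Sum>w\<in>R. (1 + chi (w ^ 2 - 4 * 1)) * ?F w)"
    using p_gt_2 by (intro sum_plus_recip per_F) simp
  also have "\<dots> = (\<Sum>w\<in>R. ?F w) + (\<Sum>w\<in>R. chi (w ^ 2 - 4) * ?F w)"
    by (simp add: algebra_simps sum.distrib)
  also have "(\<Sum>w\<in>R. chi (w ^ 2 - 4) * ?F w)
      = (\<Sum>w\<in>R. ?F (- w) - (if w = int p - 2 then 1 else 0))"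
  proof (rule sum.cong[OF refl])
    fix w assume w: "w \<in> R"
    have "(w ^ 2 - 4) * ((w + 2) * (w * (w ^ 2 - 8))) = (w + 2) ^ 2 * ((- w + 2) * (- w * ((- w) ^ 2 - 8)))"
      by (simp add: power2_eq_square algebra_simps)
    hence *: "chi (w ^ 2 - 4) * ?F w = chi ((w + 2) ^ 2 * ((- w + 2) * (- w * ((- w) ^ 2 - 8))))"
      by (metis chi_mult)
    show "chi (w ^ 2 - 4) * ?F w = ?F (- w) - (if w = int p - 2 then 1 else 0)"
    proof (cases "int p dvd w + 2")
      case True
      hence "[w = int p - 2] (mod int p)" by (simp add: cong_iff_dvd_diff algebra_simps dvd_diff)
      moreover have "int p - 2 \<in> R" using p_gt_2 by (simp add: R_def)
      ultimately have w2: "w = int p - 2" using R_inj w by blast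
      have "[- w = - (- 2)] (mod int p)"
        using True dvd_minus_iff[of "int p" "w + 2"] by (simp add: cong_iff_dvd_diff)
      hence "?F (- w) = ?F (- (- 2))" by (rule perD[OF per_F])
      also have "\<dots> = 1" using chi_8 by simp
      finally show ?thesis using * w2 True by (simp add: chi_mult chi_power chi_eq_0_iff)
    next
      case False
      hence "w \<noteq> int p - 2" by auto
      thus ?thesis unfolding * chi_times_square[OF False] by simp
    qed
  qed
  also have "\<dots> = (\<Sum>w\<in>R. ?F w) - 1"
    using sum_reflect[OF per_F] p_gt_2 by (simp add: sum_subtractf) (simp add: R_def)
  also have "(\<Sum>w\<in>R. ?F w) = (\<Sum>v\<in>R. chi ((1 + 2 * v) * (1 - 8 * v ^ 2))) - 1"
  proof -
    have "(\<Sum>w\<in>R. ?F w) = (\<Sum>v\<in>R-{0}. ?F (recip v))"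
      using sum_inverse[OF per_F] by (simp add: sum_R_split)
    also have "\<dots> = (\<Sum>v\<in>R-{0}. chi ((1 + 2 * v) * (1 - 8 * v ^ 2)))"
    proof (rule sum.cong[OF refl])
      fix v assume v: "v \<in> R - {0}"
      have r: "[v * recip v = 1] (mod int p)" by (rule recip[OF nz[OF v]])
      have "v ^ 4 * ((recip v + 2) * (recip v * (recip v ^ 2 - 8)))
          = (v * recip v + 2 * v) * ((v * recip v) * ((v * recip v) ^ 2 - 8 * v ^ 2))"
        by (simp add: power2_eq_square power4_eq_xxxx algebra_simps)
      also have "[\<dots> = (1 + 2 * v) * (1 * (1 ^ 2 - 8 * v ^ 2))] (mod int p)"
        by (intro cong_mult cong_add cong_diff cong_pow cong_refl r)
      finally show "?F (recip v) = chi ((1 + 2 * v) * (1 - 8 * v ^ 2))"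
        by (intro chi_eq_cancel[OF nz[OF v], of 4]) simp_all
    qed
    finally show ?thesis by (simp add: sum_R_split)
  qed
  also have "(\<Sum>v\<in>R. chi ((1 + 2 * v) * (1 - 8 * v ^ 2))) = cubic_sum"
  proof -
    let ?G = "\<lambda>y. chi (y * (y ^ 2 + 4 * y + 2))"
    have "cubic_sum = (\<Sum>v\<in>R. ?G ((-4) * v + (-2)))"
      unfolding cubic_sum_def using not_dvd_power2[of 2]
      by (intro sum_affine[symmetric]) (auto intro!: per_intros)
    also have "\<dots> = (\<Sum>v\<in>R. chi ((1 + 2 * v) * (1 - 8 * v ^ 2)))"
    proof (rule sum.cong[OF refl])
      fix v :: int
      have "((-4) * v + (-2)) * (((-4) * v + (-2)) ^ 2 + 4 * ((-4) * v + (-2)) + 2)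
          = 2 ^ 2 * ((1 + 2 * v) * (1 - 8 * v ^ 2))"
        by (simp add: power2_eq_square algebra_simps)
      thus "?G ((-4) * v + (-2)) = chi ((1 + 2 * v) * (1 - 8 * v ^ 2))"
        by (simp only: chi_times_square[OF not_dvd_2])
    qed
    finally show ?thesis by simp
  qed
  finally show ?thesis by (simp add: sum_R_split)
qed

end

section \<open>Gaussian integers\<close>

text \<open>The ring of Gaussian integers, with selectors for the real and the imaginary part.\<close>

datatype gint = GI (gre: int) (gim: int)

lemma gint_eq_iff: "a = b \<longleftrightarrow> gre a = gre b \<and> gim a = gim b"
  by (cases a; cases b) auto

instantiation gint :: comm_ring_1
begin
definition "0 = GI 0 0"
definition "1 = GI 1 0"
definition "a + b = GI (gre a + gre b) (gim a + gim b)"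
definition "a - b = GI (gre a - gre b) (gim a - gim b)"
definition "- a = GI (- gre a) (- gim a)"
definition "a * b = GI (gre a * gre b - gim a * gim b) (gre a * gim b + gim a * gre b)"
instance
  by standard
     (auto simp: zero_gint_def one_gint_def plus_gint_def minus_gint_def uminus_gint_def times_gint_def
        algebra_simps)
end

lemma gint_sel [simp]:
  "gre 0 = 0" "gim 0 = 0" "gre 1 = 1" "gim 1 = 0"
  "gre (a + b) = gre a + gre b" "gim (a + b) = gim a + gim b"
  "gre (a * b) = gre a * gre b - gim a * gim b" "gim (a * b) = gre a * gim b + gim a * gre b"
  by (simp_all add: zero_gint_def one_gint_def plus_gint_def times_gint_def)

lemma gint_sel_of_nat: "gre (of_nat n) = int n \<and> gim (of_nat n) = 0"
  by (induction n) auto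

lemma gint_sel_of_int [simp]: "gre (of_int c) = c" "gim (of_int c) = 0"
  using gint_sel_of_nat by (cases c; simp add: uminus_gint_def flip: of_nat_Suc)+

lemma gint_sel_numeral [simp]: "gre (numeral k) = numeral k" "gim (numeral k) = 0"
  using gint_sel_of_int[of "numeral k"] by simp_all

definition gcnj :: "gint \<Rightarrow> gint" where "gcnj a = GI (gre a) (- gim a)"
definition gnorm :: "gint \<Rightarrow> int" where "gnorm a = gre a ^ 2 + gim a ^ 2"

lemma gcnj_sel [simp]: "gre (gcnj a) = gre a" "gim (gcnj a) = - gim a"
  by (simp_all add: gcnj_def)

lemma gcnj_mult: "gcnj (a * b) = gcnj a * gcnj b"
  by (simp add: gint_eq_iff)

lemma gcnj_power: "gcnj (a ^ k) = gcnj a ^ k"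
  by (induction k) (auto simp: gcnj_mult gint_eq_iff)

lemma gcnj_cnj [simp]: "gcnj (gcnj a) = a" by (simp add: gint_eq_iff)

lemma gnorm_mult: "gnorm (a * b) = gnorm a * gnorm b"
  by (simp add: gnorm_def power2_eq_square algebra_simps)

lemma gnorm_power: "gnorm (a ^ k) = gnorm a ^ k"
  by (induction k) (auto simp: gnorm_mult, simp add: gnorm_def)

lemma gnorm_cnj [simp]: "gnorm (gcnj a) = gnorm a" by (simp add: gnorm_def)

lemma mult_gcnj: "a * gcnj a = of_int (gnorm a)"
  by (simp add: gint_eq_iff gnorm_def power2_eq_square)

lemma gnorm_of_int [simp]: "gnorm (of_int c) = c ^ 2" by (simp add: gnorm_def)

context odd_prime
begin

text \<open>Congruence modulo \<open>p\<close> of Gaussian integers. The quotient ring is a field for \<open>p \<equiv> 3\<close> and a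
  product of two fields for \<open>p \<equiv> 1\<close> modulo \<open>4\<close>; in both cases a class is a unit if and only if \<open>p\<close> does not
  divide its norm.\<close>

definition gcong :: "gint \<Rightarrow> gint \<Rightarrow> bool" where
  "gcong a b \<longleftrightarrow> [gre a = gre b] (mod int p) \<and> [gim a = gim b] (mod int p)"

lemma gcong_refl [simp]: "gcong a a" by (simp add: gcong_def)
lemma gcong_sym: "gcong a b \<Longrightarrow> gcong b a" by (simp add: gcong_def cong_sym)
lemma gcong_trans [trans]: "gcong a b \<Longrightarrow> gcong b c \<Longrightarrow> gcong a c" unfolding gcong_def by (blast intro: cong_trans)
lemma gcong_mult: "gcong a b \<Longrightarrow> gcong c d \<Longrightarrow> gcong (a * c) (b * d)"
  by (auto simp: gcong_def intro!: cong_add cong_diff cong_mult)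
lemma gcong_power: "gcong a b \<Longrightarrow> gcong (a ^ k) (b ^ k)"
  by (induction k) (auto intro: gcong_mult)
lemma gcong_cnj: "gcong a b \<Longrightarrow> gcong (gcnj a) (gcnj b)"
  by (simp add: gcong_def cong_minus_minus_iff)
lemma gcong_of_int: "[a = b] (mod int p) \<Longrightarrow> gcong (of_int a) (of_int b)"
  by (simp add: gcong_def)
lemma gcong_norm: "gcong a b \<Longrightarrow> [gnorm a = gnorm b] (mod int p)"
  by (auto simp: gcong_def gnorm_def intro!: cong_add cong_pow)
lemma gcong_re: "gcong a b \<Longrightarrow> [gre a = gre b] (mod int p)"
  by (simp add: gcong_def)

text \<open>The standard representatives of the Gaussian integers modulo \<open>p\<close>.\<close>

definition GR :: "gint set" where "GR = {z. gre z \<in> R \<and> gim z \<in> R}"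

lemma GR_eq: "GR = (\<lambda>(x, y). GI x y) ` (R \<times> R)"
  by (auto simp: GR_def image_iff) (metis gint.collapse)

lemma finite_GR [simp]: "finite GR" by (simp add: GR_eq)

lemma sum_GR: "(\<Sum>z\<in>GR. F z) = (\<Sum>x\<in>R. \<Sum>y\<in>R. F (GI x y))"
proof -
  have "(\<Sum>z\<in>GR. F z) = (\<Sum>(x, y)\<in>R \<times> R. F (GI x y))"
    unfolding GR_eq by (subst sum.reindex) (auto simp: inj_on_def case_prod_unfold)
  thus ?thesis by (simp add: sum.cartesian_product)
qed

definition gper :: "(gint \<Rightarrow> 'b) \<Rightarrow> bool" where
  "gper F \<longleftrightarrow> (\<forall>a b. gcong a b \<longrightarrow> F a = F b)"

lemma gperD: "gper F \<Longrightarrow> gcong a b \<Longrightarrow> F a = F b" by (auto simp: gper_def)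

lemma gsum_subst:
  fixes F :: "gint \<Rightarrow> 'b :: comm_monoid_add"
  assumes F: "gper F" and f: "\<And>x y. gcong (f x) (f y) \<Longrightarrow> gcong x y"
  shows "(\<Sum>x\<in>GR. F (f x)) = (\<Sum>x\<in>GR. F x)"
proof -
  let ?g = "\<lambda>x. GI (gre (f x) mod int p) (gim (f x) mod int p)"
  have "inj_on ?g GR"
  proof (rule inj_onI)
    fix x y assume xy: "x \<in> GR" "y \<in> GR" "?g x = ?g y"
    hence "gcong (f x) (f y)" by (simp add: gcong_def cong_def)
    hence "gcong x y" by (rule f)
    thus "x = y" using xy R_inj unfolding gcong_def GR_def gint_eq_iff by blast
  qed
  moreover have "?g ` GR \<subseteq> GR" by (auto simp: GR_def)
  ultimately have "?g ` GR = GR" by (intro endo_inj_surj) auto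
  hence "(\<Sum>x\<in>GR. F x) = (\<Sum>x\<in>GR. F (?g x))" using sum.reindex[OF \<open>inj_on ?g GR\<close>, of F] by simp
  also have "\<dots> = (\<Sum>x\<in>GR. F (f x))"
    by (intro sum.cong gperD[OF F]) (auto simp: gcong_def)
  finally show ?thesis by simp
qed

lemma gcong_mult_cancel:
  assumes d: "\<not> int p dvd gnorm d" and c: "gcong (d * x) (d * y)"
  shows "gcong x y"
proof -
  have "gcong (gcnj d * (d * x)) (gcnj d * (d * y))" by (rule gcong_mult[OF gcong_refl c])
  moreover have "gcnj d * (d * z) = of_int (gnorm d) * z" for z
    by (simp add: mult_gcnj[symmetric] ac_simps)
  ultimately have "gcong (of_int (gnorm d) * x) (of_int (gnorm d) * y)" by simp
  thus ?thesis using cong_mult_cancel[OF d] by (simp add: gcong_def)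
qed

lemma gsum_mult: "gper F \<Longrightarrow> \<not> int p dvd gnorm d \<Longrightarrow> (\<Sum>x\<in>GR. F (d * x)) = (\<Sum>x\<in>GR. F x)"
  by (rule gsum_subst) (auto intro: gcong_mult_cancel)

lemma gsum_cnj: "gper F \<Longrightarrow> (\<Sum>x\<in>GR. F (gcnj x)) = (\<Sum>x\<in>GR. F x)"
proof (rule gsum_subst)
  fix x y assume "gcong (gcnj x) (gcnj y)"
  thus "gcong x y" using gcong_cnj[of "gcnj x" "gcnj y"] by simp
qed

section \<open>A family of quartic character sums\<close>

text \<open>The family of character sums \<open>T(c) = \<Sum> \<chi>(Re (c b^4) N(b))\<close> with \<open>b\<close> running over the Gaussian
  integers modulo \<open>p\<close>.\<close>

definition quartic_sum :: "gint \<Rightarrow> int" where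
  "quartic_sum c = (\<Sum>b\<in>GR. chi (gre (c * b ^ 4) * gnorm b))"

lemma quartic_sum_cong: "gcong a b \<Longrightarrow> quartic_sum a = quartic_sum b"
  unfolding quartic_sum_def by (intro sum.cong refl chi_cong cong_mult cong_refl gcong_re gcong_mult gcong_refl)

lemma gper_quartic_summand: "gper (\<lambda>b. chi (gre (c * b ^ 4) * gnorm b))"
  unfolding gper_def by (intro allI impI chi_cong cong_mult gcong_norm gcong_re gcong_mult gcong_power gcong_refl)

lemma quartic_sum_mult_power4:
  assumes "\<not> int p dvd gnorm d"
  shows "quartic_sum (c * d ^ 4) = chi (gnorm d) * quartic_sum c"
proof -
  have "quartic_sum c = (\<Sum>b\<in>GR. chi (gre (c * (d * b) ^ 4) * gnorm (d * b)))"
    unfolding quartic_sum_def by (rule gsum_mult[OF gper_quartic_summand assms, symmetric])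
  also have "\<dots> = (\<Sum>b\<in>GR. chi (gnorm d) * chi (gre (c * d ^ 4 * b ^ 4) * gnorm b))"
    by (intro sum.cong refl) (simp only: gnorm_mult chi_mult power_mult_distrib mult.assoc mult.left_commute)
  also have "\<dots> = chi (gnorm d) * quartic_sum (c * d ^ 4)" by (simp add: quartic_sum_def sum_distrib_left)
  finally have "chi (gnorm d) * quartic_sum c = (chi (gnorm d) * chi (gnorm d)) * quartic_sum (c * d ^ 4)" by simp
  thus ?thesis using chi_square[OF assms] by simp
qed

lemma quartic_sum_scale: "quartic_sum (of_int a * c) = chi a * quartic_sum c"
  unfolding quartic_sum_def sum_distrib_left
  by (intro sum.cong refl) (simp add: mult.assoc chi_mult)

lemma quartic_sum_cnj: "quartic_sum (gcnj c) = quartic_sum c"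
proof -
  have "quartic_sum (gcnj c) = (\<Sum>b\<in>GR. chi (gre (gcnj c * gcnj b ^ 4) * gnorm (gcnj b)))"
    unfolding quartic_sum_def by (rule gsum_cnj[OF gper_quartic_summand, symmetric])
  also have "\<dots> = quartic_sum c" by (simp add: quartic_sum_def flip: gcnj_power gcnj_mult)
  finally show ?thesis .
qed

lemma chi_eq_sign_not_dvd: "chi a = 1 \<or> chi a = -1 \<Longrightarrow> \<not> int p dvd a"
  using chi_eq_0_iff[of a] by auto

text \<open>Conjugation fixes the family member at \<open>d^2\<close>, and also changes its sign if \<open>N(d)\<close> is not a square,
  because the conjugate of \<open>d^2\<close> times \<open>d^4\<close> is \<open>N(d)^2 d^2\<close>.\<close>

lemma quartic_sum_square_zero:
  assumes "chi (gnorm d) = -1"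
  shows "quartic_sum (d ^ 2) = 0"
proof -
  have d: "\<not> int p dvd gnorm d" using assms chi_eq_sign_not_dvd by blast
  have "gcnj d ^ 2 * d ^ 4 = (d * gcnj d) ^ 2 * d ^ 2"
    by (simp add: power2_eq_square power4_eq_xxxx algebra_simps)
  also have "\<dots> = of_int (gnorm d ^ 2) * d ^ 2" by (simp add: mult_gcnj)
  finally have "quartic_sum (gcnj d ^ 2 * d ^ 4) = chi (gnorm d ^ 2) * quartic_sum (d ^ 2)" by (simp only: quartic_sum_scale)
  moreover have "quartic_sum (gcnj d ^ 2) = quartic_sum (d ^ 2)" by (simp add: quartic_sum_cnj flip: gcnj_power)
  ultimately show ?thesis using quartic_sum_mult_power4[OF d, of "gcnj d ^ 2"] assms chi_power_even[OF d, of 2] by simp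
qed

text \<open>If \<open>N(c) = n^2\<close>, then \<open>(c + n)^2 = c (2 Re c + 2 n)\<close>; at least one of the two signs of \<open>n\<close> makes
  the rational factor invertible.\<close>

lemma square_class:
  assumes "chi (gnorm c) = 1"
  shows "\<exists>a d. \<not> int p dvd a \<and> \<not> int p dvd gnorm d \<and> gcong c (of_int a * d ^ 2)"
proof -
  obtain n where n: "[n ^ 2 = gnorm c] (mod int p)" "\<not> int p dvd n" using chi_eq_1D[OF assms] by blast
  have *: ?thesis if n: "[n ^ 2 = gnorm c] (mod int p)" "\<not> int p dvd n" and u: "\<not> int p dvd 2 * gre c + 2 * n" for n
  proof -
    let ?u = "2 * gre c + 2 * n" and ?d = "c + of_int n"
    have "gcong (?d ^ 2) (of_int ?u * c)"
      using n(1) by (simp add: gcong_def gnorm_def power2_eq_square cong_iff_dvd_diff algebra_simps)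
    hence "gcong (of_int (recip ?u) * ?d ^ 2) (of_int (recip ?u) * (of_int ?u * c))"
      by (rule gcong_mult[OF gcong_refl])
    also have "of_int (recip ?u) * (of_int ?u * c) = of_int (?u * recip ?u) * c" by (simp add: ac_simps)
    also have "gcong \<dots> (of_int 1 * c)" by (intro gcong_mult gcong_of_int gcong_refl recip u)
    finally have "gcong c (of_int (recip ?u) * ?d ^ 2)" by (simp add: gcong_sym)
    moreover have "\<not> int p dvd gnorm ?d"
    proof
      assume "int p dvd gnorm ?d"
      moreover have "gnorm ?d = (gnorm c - n ^ 2) + n * ?u"
        by (simp add: gnorm_def power2_eq_square algebra_simps)
      moreover have "int p dvd gnorm c - n ^ 2" using n(1) by (simp add: cong_iff_dvd_diff dvd_diff_commute)
      ultimately have "int p dvd n * ?u" by (simp only: dvd_add_right_iff)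
      thus False using not_dvd_mult[OF n(2) u] by simp
    qed
    ultimately show ?thesis using recip_nonzero[OF u] by blast
  qed
  show ?thesis
  proof (cases "int p dvd 2 * gre c + 2 * n")
    case False thus ?thesis using * n by blast
  next
    case True
    have "\<not> int p dvd 2 * gre c + 2 * (- n)"
    proof
      assume "int p dvd 2 * gre c + 2 * (- n)"
      from dvd_diff[OF True this] have "int p dvd 2 ^ 2 * n" by simp
      thus False using not_dvd_mult[OF not_dvd_power2[of 2] n(2)] by simp
    qed
    thus ?thesis using *[of "- n"] n by simp
  qed
qed

text \<open>The square of the sum depends only on the class of \<open>c\<close> modulo fourth powers and integers.
  The units modulo these form a cyclic group of order \<open>4\<close>. The square takes the same value on the two classes
  of nonsquare norm, vanishes on the class of squares that are not fourth powers, and has its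
  value at \<open>1\<close> on the trivial class.\<close>

definition quartic_sq :: "gint \<Rightarrow> int" where "quartic_sq c = quartic_sum c ^ 2"

lemma quartic_sq_cong: "gcong a b \<Longrightarrow> quartic_sq a = quartic_sq b" by (simp add: quartic_sq_def quartic_sum_cong)
lemma quartic_sq_scale: "\<not> int p dvd a \<Longrightarrow> quartic_sq (of_int a * c) = quartic_sq c"
  by (simp add: quartic_sq_def quartic_sum_scale power_mult_distrib chi_square power2_eq_square)
lemma quartic_sq_mult_power4: "\<not> int p dvd gnorm d \<Longrightarrow> quartic_sq (c * d ^ 4) = quartic_sq c"
  by (simp add: quartic_sq_def quartic_sum_mult_power4 power_mult_distrib chi_square power2_eq_square)
lemma quartic_sq_cnj: "quartic_sq (gcnj c) = quartic_sq c" by (simp add: quartic_sq_def quartic_sum_cnj)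

lemma quartic_sq_square_class:
  assumes "chi (gnorm d) = 1"
  shows "quartic_sq (c * d ^ 2) = quartic_sq c"
proof -
  obtain a e where a: "\<not> int p dvd a" and e: "\<not> int p dvd gnorm e" and d: "gcong d (of_int a * e ^ 2)"
    using square_class[OF assms] by blast
  have "gcong (c * d ^ 2) (c * (of_int a * e ^ 2) ^ 2)" by (intro gcong_mult gcong_power d gcong_refl)
  also have "c * (of_int a * e ^ 2) ^ 2 = of_int (a ^ 2) * (c * e ^ 4)"
    by (simp add: power2_eq_square power4_eq_xxxx algebra_simps)
  finally have "quartic_sq (c * d ^ 2) = quartic_sq (of_int (a ^ 2) * (c * e ^ 4))" by (rule quartic_sq_cong)
  thus ?thesis using quartic_sq_scale[of "a ^ 2"] a quartic_sq_mult_power4[OF e] prime_dvd_power[OF prime_int_p, of a 2] by metis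
qed

lemma quartic_sq_nonresidue:
  assumes c: "chi (gnorm c) = -1" and g: "chi (gnorm g) = -1"
  shows "quartic_sq c = quartic_sq g"
proof -
  have cg: "chi (gnorm (c * gcnj g)) = 1" by (simp add: gnorm_mult chi_mult assms)
  obtain a d where a: "\<not> int p dvd a" and d: "\<not> int p dvd gnorm d" and cd: "gcong (c * gcnj g) (of_int a * d ^ 2)"
    using square_class[OF cg] by blast
  have ng: "\<not> int p dvd gnorm g" using g chi_eq_sign_not_dvd by blast
  have "quartic_sq c = quartic_sq (of_int (gnorm g) * c)" using quartic_sq_scale[OF ng] by simp
  also have "of_int (gnorm g) * c = (c * gcnj g) * g" by (simp add: mult_gcnj[symmetric] ac_simps)
  also have "quartic_sq \<dots> = quartic_sq (of_int a * (g * d ^ 2))"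
    by (rule quartic_sq_cong) (use gcong_mult[OF cd gcong_refl[of g]] in \<open>simp add: ac_simps\<close>)
  also have "\<dots> = quartic_sq (g * d ^ 2)" by (rule quartic_sq_scale[OF a])
  also have "\<dots> = quartic_sq g"
  proof (cases "chi (gnorm d) = 1")
    case True thus ?thesis by (rule quartic_sq_square_class)
  next
    case False
    hence "chi (gnorm d) = -1" using chi_values[of "gnorm d"] chi_eq_0_iff d by auto
    hence "chi (gnorm (g * d)) = 1" by (simp add: gnorm_mult chi_mult g)
    hence "quartic_sq (gcnj g * (g * d) ^ 2) = quartic_sq (gcnj g)" by (rule quartic_sq_square_class)
    moreover have "gcnj g * (g * d) ^ 2 = of_int (gnorm g) * (g * d ^ 2)"
      by (simp add: mult_gcnj[symmetric] power2_eq_square algebra_simps)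
    ultimately show ?thesis using quartic_sq_scale[OF ng] quartic_sq_cnj by simp
  qed
  finally show ?thesis .
qed

lemma quartic_sq_residue:
  assumes c: "chi (gnorm c) = 1" and g: "chi (gnorm g) = -1"
  shows "quartic_sq c + quartic_sq (g ^ 2 * c) = quartic_sq 1"
proof -
  obtain a d where a: "\<not> int p dvd a" and d: "\<not> int p dvd gnorm d" and cd: "gcong c (of_int a * d ^ 2)"
    using square_class[OF c] by blast
  have 1: "quartic_sq c = quartic_sq (d ^ 2)" using quartic_sq_cong[OF cd] quartic_sq_scale[OF a] by simp
  have "gcong (g ^ 2 * c) (g ^ 2 * (of_int a * d ^ 2))" by (intro gcong_mult cd gcong_refl)
  also have "g ^ 2 * (of_int a * d ^ 2) = of_int a * (g * d) ^ 2" by (simp add: power2_eq_square algebra_simps)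
  finally have 2: "quartic_sq (g ^ 2 * c) = quartic_sq ((g * d) ^ 2)" using quartic_sq_cong quartic_sq_scale[OF a] by metis
  show ?thesis
  proof (cases "chi (gnorm d) = 1")
    case True
    hence "quartic_sq (d ^ 2) = quartic_sq 1" using quartic_sq_square_class[of d 1] by simp
    moreover have "chi (gnorm (g * d)) = -1" using True g by (simp add: gnorm_mult chi_mult)
    ultimately show ?thesis using 1 2 quartic_sum_square_zero by (simp add: quartic_sq_def)
  next
    case False
    hence nd: "chi (gnorm d) = -1" using chi_values[of "gnorm d"] chi_eq_0_iff d by auto
    hence "chi (gnorm (g * d)) = 1" by (simp add: gnorm_mult chi_mult g)
    hence "quartic_sq ((g * d) ^ 2) = quartic_sq 1" using quartic_sq_square_class[of "g * d" 1] by simp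
    thus ?thesis using 1 2 quartic_sum_square_zero[OF nd] by (simp add: quartic_sq_def)
  qed
qed

text \<open>The elements \<open>c\<close>, \<open>g c\<close>, \<open>g^2 c\<close> and \<open>g^3 c\<close> represent the four classes.\<close>

lemma quartic_sq_coset_sum:
  assumes c: "\<not> int p dvd gnorm c" and g: "chi (gnorm g) = -1"
  shows "quartic_sq c + quartic_sq (g * c) + quartic_sq (g ^ 2 * c) + quartic_sq (g ^ 3 * c) = quartic_sq 1 + 2 * quartic_sq g"
proof -
  have g3: "g ^ 3 * c = g ^ 2 * (g * c)" by (simp add: power2_eq_square power3_eq_cube ac_simps)
  show ?thesis
  proof (cases "chi (gnorm c) = 1")
    case True
    thus ?thesis
      using quartic_sq_residue[OF True g] quartic_sq_nonresidue[of "g * c" g] quartic_sq_nonresidue[of "g ^ 3 * c" g] g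
      by (simp add: gnorm_mult chi_mult gnorm_power chi_power)
  next
    case False
    hence nc: "chi (gnorm c) = -1" using chi_values[of "gnorm c"] chi_eq_0_iff c by auto
    thus ?thesis
      using quartic_sq_residue[of "g * c" g] quartic_sq_nonresidue[of c g] quartic_sq_nonresidue[of "g ^ 2 * c" g] g
      unfolding g3 by (simp add: gnorm_mult chi_mult gnorm_power chi_power)
  qed
qed

text \<open>A nonunit \<open>c\<close> satisfies \<open>d c \<equiv> l c\<close> for an integer \<open>l\<close>, where \<open>d\<close> has nonsquare norm. Multiplication of
  \<open>c\<close> by \<open>d^4\<close> therefore multiplies the sum by \<open>-1\<close> and by \<open>\<chi>(l^4)\<close>, which is \<open>0\<close> or \<open>1\<close>.\<close>

lemma quartic_sum_nonunit:
  assumes "int p dvd gnorm c"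
  shows "quartic_sum c = 0"
proof -
  obtain a where a: "chi (a ^ 2 + 1) = -1" using ex_nonresidue_sum_two_squares by blast
  define d where "d = GI a 1"
  have nd: "chi (gnorm d) = -1" using a by (simp add: d_def gnorm_def)
  let ?u = "gre c" and ?v = "gim c"
  have uv: "int p dvd ?u ^ 2 + ?v ^ 2" using assms by (simp add: gnorm_def)
  show ?thesis
  proof (cases "int p dvd ?u")
    case True
    hence "int p dvd ?v ^ 2" using uv by (simp add: power2_eq_square dvd_add_right_iff)
    hence "int p dvd ?v" using prime_dvd_power[OF prime_int_p] by blast
    hence "gcong c (of_int 0 * c)" using True by (simp add: gcong_def cong_0_iff)
    hence "quartic_sum c = chi 0 * quartic_sum c" using quartic_sum_cong quartic_sum_scale by metis
    thus ?thesis by simp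
  next
    case False
    define l where "l = a - ?v * recip ?u"
    have r: "int p dvd ?u * recip ?u - 1" using recip[OF False] by (simp add: cong_iff_dvd_diff)
    have "gcong (d * c) (of_int l * c)"
    proof -
      have "(a * ?u - ?v) - l * ?u = ?v * (?u * recip ?u - 1)" by (simp add: l_def algebra_simps)
      moreover have "(a * ?v + ?u) - l * ?v = (?u ^ 2 + ?v ^ 2) * recip ?u - ?u * (?u * recip ?u - 1)"
        by (simp add: l_def power2_eq_square algebra_simps)
      moreover have "int p dvd (?u ^ 2 + ?v ^ 2) * recip ?u - ?u * (?u * recip ?u - 1)"
        by (rule dvd_diff[OF dvd_mult2[OF uv] dvd_mult[OF r]])
      moreover have "int p dvd ?v * (?u * recip ?u - 1)" using r by (rule dvd_mult)
      ultimately have "int p dvd (a * ?u - ?v) - l * ?u" "int p dvd (a * ?v + ?u) - l * ?v"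
        by simp_all
      thus ?thesis by (simp add: gcong_def cong_iff_dvd_diff d_def)
    qed
    hence step: "gcong (d * (of_int b * c)) (of_int (l * b) * c)" for b
      using gcong_mult[OF gcong_refl[of "of_int b"], of "d * c" "of_int l * c"] by (simp add: ac_simps)
    have "gcong (d ^ k * c) (of_int (l ^ k) * c)" for k
    proof (induction k)
      case (Suc k)
      have "gcong (d * (d ^ k * c)) (d * (of_int (l ^ k) * c))" by (rule gcong_mult[OF gcong_refl Suc.IH])
      also have "gcong \<dots> (of_int (l * l ^ k) * c)" by (rule step)
      finally show ?case by (simp add: ac_simps)
    qed simp
    hence "gcong (c * d ^ 4) (of_int (l ^ 4) * c)" by (simp add: mult.commute)
    hence "quartic_sum (c * d ^ 4) = chi (l ^ 4) * quartic_sum c" using quartic_sum_cong quartic_sum_scale by metis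
    moreover have "quartic_sum (c * d ^ 4) = - quartic_sum c" using quartic_sum_mult_power4[of d c] nd chi_eq_sign_not_dvd by simp
    moreover have "chi (l ^ 4) = 0 \<or> chi (l ^ 4) = 1" using chi_values[of l] by (auto simp: chi_power)
    ultimately show ?thesis by auto
  qed
qed

text \<open>The number of units of the Gaussian integers modulo \<open>p\<close>.\<close>

definition unit_count :: int where "unit_count = int (card {b\<in>GR. \<not> int p dvd gnorm b})"

lemma unit_count_pos: "unit_count > 0"
proof -
  have "1 \<in> {b\<in>GR. \<not> int p dvd gnorm b}" using p_gt_2 by (auto simp: GR_def R_def gnorm_def)
  hence "card {b\<in>GR. \<not> int p dvd gnorm b} > 0" by (intro card_gt_0_iff[THEN iffD2]) auto
  thus ?thesis by (simp add: unit_count_def)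
qed

lemma sum_units: "(\<Sum>b\<in>GR. if int p dvd gnorm b then 0 else k) = unit_count * k"
proof -
  have "(\<Sum>b\<in>GR. if int p dvd gnorm b then 0 else k) = (\<Sum>b\<in>GR. if \<not> int p dvd gnorm b then k else 0)"
    by (intro sum.cong) auto
  also have "\<dots> = (\<Sum>b\<in>{b\<in>GR. \<not> int p dvd gnorm b}. k)" by (rule sum.inter_filter[symmetric]) simp
  finally show ?thesis by (simp add: unit_count_def)
qed

lemma sum_quartic_sq:
  assumes g: "chi (gnorm g) = -1"
  shows "4 * (\<Sum>c\<in>GR. quartic_sq c) = unit_count * (quartic_sq 1 + 2 * quartic_sq g)"
proof -
  have ng: "\<not> int p dvd gnorm g" using g chi_eq_sign_not_dvd by blast
  have gper_sq: "gper quartic_sq" by (simp add: gper_def quartic_sq_cong)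
  have k: "(\<Sum>c\<in>GR. quartic_sq (g ^ k * c)) = (\<Sum>c\<in>GR. quartic_sq c)" for k
    by (rule gsum_mult[OF gper_sq]) (use ng prime_dvd_power[OF prime_int_p] in \<open>auto simp: gnorm_power\<close>)
  have "(\<Sum>c\<in>GR. quartic_sq c + quartic_sq (g * c) + quartic_sq (g ^ 2 * c) + quartic_sq (g ^ 3 * c))
      = (\<Sum>c\<in>GR. if int p dvd gnorm c then 0 else quartic_sq 1 + 2 * quartic_sq g)"
    by (intro sum.cong refl) (use quartic_sq_coset_sum[OF _ g] quartic_sum_nonunit in \<open>auto simp: quartic_sq_def gnorm_mult\<close>)
  also have "\<dots> = unit_count * (quartic_sq 1 + 2 * quartic_sq g)" by (rule sum_units)
  finally show ?thesis using k[of 1] k[of 2] k[of 3] by (simp add: sum.distrib)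
qed

text \<open>If \<open>Re c\<close> and \<open>Re (s c)\<close> are linearly independent forms in \<open>c\<close>, their characters are
  uncorrelated.\<close>

lemma correlation:
  "(\<Sum>c\<in>GR. chi (gre c) * chi (gre (s * c)))
     = (if int p dvd gim s then int p * (int p - 1) * chi (gre s) else 0)"
proof -
  have "(\<Sum>c\<in>GR. chi (gre c) * chi (gre (s * c)))
      = (\<Sum>x\<in>R. chi x * (\<Sum>y\<in>R. chi ((- gim s) * y + gre s * x)))"
    by (simp add: sum_GR sum_distrib_left)
  also have "\<dots> = (if int p dvd gim s then int p * (int p - 1) * chi (gre s) else 0)"
  proof (cases "int p dvd gim s")
    case True
    have "(\<Sum>x\<in>R. chi x * (\<Sum>y\<in>R. chi ((- gim s) * y + gre s * x)))
        = (\<Sum>x\<in>R. if x = 0 then 0 else int p * chi (gre s))"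
    proof (intro sum.cong refl)
      fix x assume x: "x \<in> R"
      have "chi ((- gim s) * y + gre s * x) = chi (gre s) * chi x" for y
        using True chi_cong[of "(- gim s) * y + gre s * x" "gre s * x"] by (simp add: cong_iff_dvd_diff chi_mult)
      hence "(\<Sum>y\<in>R. chi ((- gim s) * y + gre s * x)) = int p * (chi (gre s) * chi x)" by simp
      thus "chi x * (\<Sum>y\<in>R. chi ((- gim s) * y + gre s * x)) = (if x = 0 then 0 else int p * chi (gre s))"
        using chi_square[of x] R_dvd[OF x] by simp
    qed
    also have "\<dots> = (\<Sum>x\<in>R-{0}. int p * chi (gre s))" by (simp add: sum.remove[of R 0])
    finally show ?thesis using True p_gt_2 by (simp add: of_nat_diff)
  next
    case False
    thus ?thesis using sum_chi_affine[of "- gim s"] by simp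
  qed
  finally show ?thesis .
qed

text \<open>Up to integer factors, the elements whose fourth power is real are \<open>1\<close>, \<open>i\<close>, \<open>1 + i\<close> and \<open>1 - i\<close>. Each
  of the four lines contributes \<open>p - 1\<close>; for the last two this uses that
  \<open>N(1 + i) (1 + i)^4 = -8\<close> is a square by assumption.\<close>

lemma sum_real_fourth_powers:
  assumes chi_neg2: "chi (-2) = 1"
  shows "(\<Sum>r\<in>GR. chi (gnorm r) * (if int p dvd gim (r ^ 4) then chi (gre (r ^ 4)) else 0)) = 4 * (int p - 1)"
    (is "(\<Sum>r\<in>GR. ?f r) = _")
proof -
  have chi_8: "chi (-8) = 1" using chi_times_square[OF not_dvd_2, of "-2"] chi_neg2 by simp
  have im4: "gim (GI x y ^ 4) = 2 ^ 2 * (x * (y * ((x - y) * (x + y))))"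
    and re4: "gre (GI x y ^ 4) = x ^ 4 - 6 * x ^ 2 * y ^ 2 + y ^ 4" for x y
    by (simp_all add: power4_eq_xxxx power2_eq_square algebra_simps)
  have dvd_im: "int p dvd gim (GI x y ^ 4) \<longleftrightarrow> int p dvd x \<or> int p dvd y \<or> int p dvd x - y \<or> int p dvd x + y" for x y
    using not_dvd_power2[of 2] unfolding im4 by (simp add: prime_dvd_mult_iff[OF prime_int_p])
  have "(\<Sum>y\<in>R. ?f (GI x y)) = (if x = 0 then int p - 1 else 3)" if x: "x \<in> R" for x
  proof (cases "x = 0")
    case True
    have "?f (GI x y) = (if y = 0 then 0 else 1)" if y: "y \<in> R" for y
    proof -
      have "?f (GI x y) = chi (y ^ 2 * y ^ 4)" using True dvd_im[of 0 y] re4[of 0 y] by (simp add: gnorm_def flip: chi_mult)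
      also have "y ^ 2 * y ^ 4 = y ^ 6" by (simp flip: power_add)
      finally show ?thesis using chi_power_even[of y 6] R_dvd[OF y] by auto
    qed
    hence "(\<Sum>y\<in>R. ?f (GI x y)) = (\<Sum>y\<in>R-{0}. 1)" by (simp add: sum.remove[of R 0])
    thus ?thesis using True p_gt_2 by (simp add: of_nat_diff)
  next
    case False
    have nx: "\<not> int p dvd x" using False R_dvd x by simp
    have px: "int p - x \<in> R" "int p - x \<noteq> 0" "int p - x \<noteq> x" using x False p_odd by (auto simp: R_def)
        presburger
    have f: "?f (GI x y) = (if y \<in> {0, x, int p - x} then 1 else 0)" if y: "y \<in> R" for y
    proof -
      have y1: "int p dvd y \<longleftrightarrow> y = 0" by (rule R_dvd[OF y])
      have y2: "int p dvd x - y \<longleftrightarrow> y = x" using R_inj[OF x y] by (auto simp: cong_iff_dvd_diff)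
      have y3: "int p dvd x + y \<longleftrightarrow> y = int p - x"
        using R_inj[OF y px(1)] by (auto simp: cong_iff_dvd_diff algebra_simps)
      consider "y = 0" | "y = x" | "y = int p - x" | "y \<notin> {0, x, int p - x}" by auto
      thus ?thesis
      proof cases
        case 1
        thus ?thesis using dvd_im[of x 0] re4[of x 0] chi_power_even[OF nx] by (simp add: gnorm_def)
      next
        case 2
        have "chi (gnorm (GI x x)) * chi (gre (GI x x ^ 4)) = chi ((x ^ 3) ^ 2 * (-8))"
          unfolding re4 gnorm_def chi_mult[symmetric] by (simp add: power2_eq_square power4_eq_xxxx power3_eq_cube algebra_simps)
        also have "\<dots> = 1" using chi_8 chi_times_square[of "x ^ 3"] nx prime_dvd_power[OF prime_int_p] by metis
        finally show ?thesis using 2 dvd_im[of x x] by simp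
      next
        case 3
        have c: "gcong (GI x (int p - x)) (GI x (- x))" by (simp add: gcong_def cong_iff_dvd_diff)
        have "chi (gnorm (GI x y)) * chi (gre (GI x y ^ 4)) = chi (gnorm (GI x (- x))) * chi (gre (GI x (- x) ^ 4))"
          unfolding 3 by (intro arg_cong2[of _ _ _ _ "(*)"] chi_cong gcong_norm gcong_re gcong_power c)
        also have "\<dots> = chi ((x ^ 3) ^ 2 * (-8))"
          unfolding re4 gnorm_def chi_mult[symmetric] by (simp add: power2_eq_square power4_eq_xxxx power3_eq_cube algebra_simps)
        also have "\<dots> = 1" using chi_8 chi_times_square[of "x ^ 3"] nx prime_dvd_power[OF prime_int_p] by metis
        finally show ?thesis using 3 dvd_im[of x y] y3 by simp
      next
        case 4
        thus ?thesis using dvd_im[of x y] nx y1 y2 y3 by simp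
      qed
    qed
    have "(\<Sum>y\<in>R. ?f (GI x y)) = (\<Sum>y\<in>R. if y \<in> {0, x, int p - x} then 1 else 0)"
      by (rule sum.cong[OF refl f])
    also have "\<dots> = (\<Sum>y\<in>{y\<in>R. y \<in> {0, x, int p - x}}. 1)" by (rule sum.inter_filter[symmetric]) simp
    also have "{y\<in>R. y \<in> {0, x, int p - x}} = {0, x, int p - x}" using x px by auto
    also have "(\<Sum>y\<in>{0, x, int p - x}. 1) = (3::int)" using False px by simp
    finally show ?thesis using False by simp
  qed
  hence "(\<Sum>r\<in>GR. ?f r) = (\<Sum>x\<in>R. if x = 0 then int p - 1 else 3)" by (simp add: sum_GR)
  also have "\<dots> = (int p - 1) + (\<Sum>x\<in>R-{0}. 3)" by (simp add: sum.remove[of R 0])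
  also have "\<dots> = 4 * (int p - 1)" using p_gt_2 by (simp add: of_nat_diff)
  finally show ?thesis .
qed

text \<open>Expanding the square gives a sum over pairs \<open>(b, b')\<close>. With \<open>b' = b r\<close> and \<open>c\<close> replaced by \<open>c / b^4\<close>,
  the inner sums become the correlations above.\<close>

lemma second_moment:
  assumes chi_neg2: "chi (-2) = 1"
  shows "(\<Sum>c\<in>GR. quartic_sq c) = unit_count * (4 * int p * (int p - 1) ^ 2)"
proof -
  let ?t = "\<lambda>c b. chi (gre (c * b ^ 4) * gnorm b)"
  have gper_corr: "gper (\<lambda>c. chi (gre c) * chi (gre (s * c)))" for s
    unfolding gper_def by (intro allI impI arg_cong2[of _ _ _ _ "(*)"] chi_cong gcong_re gcong_mult gcong_refl)
  have "(\<Sum>c\<in>GR. quartic_sq c) = (\<Sum>c\<in>GR. \<Sum>b\<in>GR. \<Sum>b'\<in>GR. ?t c b * ?t c b')"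
    by (simp add: quartic_sq_def quartic_sum_def power2_eq_square sum_product)
  also have "\<dots> = (\<Sum>b\<in>GR. \<Sum>c\<in>GR. \<Sum>b'\<in>GR. ?t c b * ?t c b')" by (rule sum.swap)
  also have "\<dots> = (\<Sum>b\<in>GR. if int p dvd gnorm b then 0 else 4 * int p * (int p - 1) ^ 2)"
  proof (intro sum.cong refl)
    fix b
    show "(\<Sum>c\<in>GR. \<Sum>b'\<in>GR. ?t c b * ?t c b') = (if int p dvd gnorm b then 0 else 4 * int p * (int p - 1) ^ 2)"
    proof (cases "int p dvd gnorm b")
      case True
      hence "?t c b = 0" for c by (simp add: chi_eq_0_iff)
      thus ?thesis using True by simp
    next
      case False
      have nb4: "\<not> int p dvd gnorm (b ^ 4)"
        using False prime_dvd_power[OF prime_int_p] by (auto simp: gnorm_power)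
      have "(\<Sum>c\<in>GR. \<Sum>b'\<in>GR. ?t c b * ?t c b') = (\<Sum>c\<in>GR. \<Sum>r\<in>GR. ?t c b * ?t c (b * r))"
        unfolding sum_distrib_left[symmetric]
        by (intro sum.cong refl arg_cong2[of _ _ _ _ "(*)"] gsum_mult[OF gper_quartic_summand False, symmetric])
      also have "\<dots> = (\<Sum>r\<in>GR. \<Sum>c\<in>GR. ?t c b * ?t c (b * r))" by (rule sum.swap)
      also have "\<dots> = (\<Sum>r\<in>GR. chi (gnorm r) * (\<Sum>c\<in>GR. chi (gre (b ^ 4 * c)) * chi (gre (r ^ 4 * (b ^ 4 * c)))))"
        unfolding sum_distrib_left
      proof (intro sum.cong refl)
        fix r c
        have "?t c b * ?t c (b * r) = (chi (gnorm b) * chi (gnorm b)) *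
            (chi (gnorm r) * (chi (gre (c * b ^ 4)) * chi (gre (c * (b * r) ^ 4))))"
          by (simp only: chi_mult gnorm_mult ac_simps)
        moreover have "r ^ 4 * (b ^ 4 * c) = c * (b * r) ^ 4" by (simp only: power_mult_distrib ac_simps)
        moreover have "b ^ 4 * c = c * b ^ 4" by (rule mult.commute)
        ultimately show "?t c b * ?t c (b * r) = chi (gnorm r) * (chi (gre (b ^ 4 * c)) * chi (gre (r ^ 4 * (b ^ 4 * c))))"
          by (simp only: chi_square[OF False] mult_1_left)
      qed
      also have "\<dots> = (\<Sum>r\<in>GR. chi (gnorm r) * (\<Sum>c\<in>GR. chi (gre c) * chi (gre (r ^ 4 * c))))"
        by (intro sum.cong refl arg_cong2[of _ _ _ _ "(*)"] gsum_mult[OF gper_corr nb4])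
      also have "\<dots> = (\<Sum>r\<in>GR. (int p * (int p - 1)) *
          (chi (gnorm r) * (if int p dvd gim (r ^ 4) then chi (gre (r ^ 4)) else 0)))"
        unfolding correlation by (intro sum.cong refl) simp
      also have "\<dots> = int p * (int p - 1) * (4 * (int p - 1))"
        unfolding sum_distrib_left[symmetric] sum_real_fourth_powers[OF chi_neg2] ..
      finally show ?thesis using False by (simp add: power2_eq_square)
    qed
  qed
  also have "\<dots> = unit_count * (4 * int p * (int p - 1) ^ 2)" by (rule sum_units)
  finally show ?thesis .
qed

text \<open>The summands of the family are homogeneous of degree \<open>6\<close> in \<open>b\<close>, so that it suffices to let \<open>b\<close> run over
  the projective line: the point \<open>1\<close> and the points \<open>t + i\<close>.\<close>

definition line_sum :: "gint \<Rightarrow> int" where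
  "line_sum c = chi (gre c) + (\<Sum>t\<in>R. chi (gre (c * GI t 1 ^ 4) * (t ^ 2 + 1)))"

lemma quartic_sum_eq_line_sum: "quartic_sum c = (int p - 1) * line_sum c"
proof -
  let ?h = "\<lambda>x y. chi (gre (c * GI x y ^ 4) * gnorm (GI x y))"
  have "quartic_sum c = (\<Sum>y\<in>R. \<Sum>x\<in>R. ?h x y)" unfolding quartic_sum_def sum_GR by (rule sum.swap)
  also have "\<dots> = (\<Sum>x\<in>R. ?h x 0) + (\<Sum>y\<in>R-{0}. \<Sum>x\<in>R. ?h x y)"
    by (rule sum.remove) simp_all
  also have "(\<Sum>x\<in>R. ?h x 0) = (\<Sum>x\<in>R. if x = 0 then 0 else chi (gre c))"
  proof (intro sum.cong refl)
    fix x assume x: "x \<in> R"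
    have "gre (c * GI x 0 ^ 4) * gnorm (GI x 0) = x ^ 6 * gre c"
      by (simp add: power4_eq_xxxx gnorm_def eval_nat_numeral)
    thus "?h x 0 = (if x = 0 then 0 else chi (gre c))"
      using chi_power_even[of x 6] R_dvd[OF x] by (simp add: chi_mult)
  qed
  also have "\<dots> = (\<Sum>x\<in>R-{0}. chi (gre c))" by (simp add: sum.remove[of R 0])
  also have "\<dots> = (int p - 1) * chi (gre c)" using p_gt_2 by (simp add: of_nat_diff)
  also have "(\<Sum>y\<in>R-{0}. \<Sum>x\<in>R. ?h x y) = (\<Sum>y\<in>R-{0}. \<Sum>t\<in>R. chi (gre (c * GI t 1 ^ 4) * (t ^ 2 + 1)))"
  proof (rule sum.cong[OF refl])
    fix y assume "y \<in> R - {0}"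
    hence y: "\<not> int p dvd y" using R_dvd by auto
    have per: "per (\<lambda>x. ?h x y)"
      unfolding per_def by (intro allI impI chi_cong cong_mult gcong_norm gcong_re gcong_mult gcong_power gcong_refl)
         (simp_all add: gcong_def)
    have "(\<Sum>x\<in>R. ?h x y) = (\<Sum>t\<in>R. ?h (y * t + 0) y)" by (rule sum_affine[OF per y, symmetric])
    also have "\<dots> = (\<Sum>t\<in>R. chi (gre (c * GI t 1 ^ 4) * (t ^ 2 + 1)))"
    proof (rule sum.cong[OF refl])
      fix t
      have e: "GI (y * t + 0) y = of_int y * GI t 1" by (simp add: gint_eq_iff)
      have "gre (c * GI (y * t + 0) y ^ 4) * gnorm (GI (y * t + 0) y)
          = y ^ 4 * gre (c * GI t 1 ^ 4) * (y ^ 2 * gnorm (GI t 1))"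
      proof -
        have "c * GI (y * t + 0) y ^ 4 = of_int (y ^ 4) * (c * GI t 1 ^ 4)"
          unfolding e by (simp add: power_mult_distrib ac_simps)
        moreover have "gre (of_int (y ^ 4) * (c * GI t 1 ^ 4)) = y ^ 4 * gre (c * GI t 1 ^ 4)"
          by (simp only: gint_sel(7) gint_sel_of_int)
        ultimately show ?thesis by (simp only: e gnorm_mult gnorm_of_int)
      qed
      also have "\<dots> = y ^ 6 * (gre (c * GI t 1 ^ 4) * (t ^ 2 + 1))"
        by (simp add: gnorm_def eval_nat_numeral)
      finally show "?h (y * t + 0) y = chi (gre (c * GI t 1 ^ 4) * (t ^ 2 + 1))"
        using chi_power_even[OF y, of 6] by (simp add: chi_mult)
    qed
    finally show "(\<Sum>x\<in>R. ?h x y) = (\<Sum>t\<in>R. chi (gre (c * GI t 1 ^ 4) * (t ^ 2 + 1)))" .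
  qed
  also have "\<dots> = (int p - 1) * (\<Sum>t\<in>R. chi (gre (c * GI t 1 ^ 4) * (t ^ 2 + 1)))"
    using p_gt_2 by (simp add: of_nat_diff)
  finally show ?thesis by (simp add: line_sum_def distrib_left)
qed

lemma line_sum_norm_equation:
  assumes "chi (-2) = 1"
  shows "\<exists>b. line_sum 1 ^ 2 + 2 * b ^ 2 = 16 * int p"
proof -
  obtain a where a: "chi (a ^ 2 + 1) = -1" using ex_nonresidue_sum_two_squares by blast
  have g: "chi (gnorm (GI a 1)) = -1" using a by (simp add: gnorm_def)
  have "unit_count * (quartic_sq 1 + 2 * quartic_sq (GI a 1)) = unit_count * (16 * int p * (int p - 1) ^ 2)"
    unfolding sum_quartic_sq[OF g, symmetric] second_moment[OF assms] by simp
  hence "quartic_sq 1 + 2 * quartic_sq (GI a 1) = 16 * int p * (int p - 1) ^ 2" using unit_count_pos by simp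
  hence "(int p - 1) ^ 2 * (line_sum 1 ^ 2 + 2 * line_sum (GI a 1) ^ 2) = (int p - 1) ^ 2 * (16 * int p)"
    by (simp only: quartic_sq_def quartic_sum_eq_line_sum power_mult_distrib distrib_left mult.left_commute mult.commute)
  moreover have "(int p - 1) ^ 2 \<noteq> 0" using p_gt_2 by simp
  ultimately show ?thesis by (metis mult_cancel_left)
qed

end

context odd_prime
begin

section \<open>Hasse invariants and isogenies\<close>

text \<open>Coefficientwise congruence modulo \<open>p\<close> of power series with integer coefficients.\<close>

definition fcong :: "int fps \<Rightarrow> int fps \<Rightarrow> bool" where
  "fcong F G \<longleftrightarrow> of_nat p dvd F - G"

lemma fcong_mult_right: "fcong F G \<Longrightarrow> fcong (F * H) (G * H)"
  by (simp add: fcong_def flip: left_diff_distrib)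

lemma fcong_trans: "fcong F G \<Longrightarrow> fcong G H \<Longrightarrow> fcong F H"
  unfolding fcong_def by (drule (1) dvd_add) simp

lemma fcong_power: "fcong F G \<Longrightarrow> fcong (F ^ k) (G ^ k)"
proof (induction k)
  case 0
  show ?case by (simp add: fcong_def)
next
  case (Suc k)
  have "fcong (F ^ k * F) (G ^ k * F)" using Suc by (intro fcong_mult_right) simp
  moreover have "fcong (F * G ^ k) (G * G ^ k)" using Suc.prems by (rule fcong_mult_right)
  ultimately show ?case using fcong_trans by (simp add: mult.commute)
qed

lemma fcong_nth: "fcong F G \<Longrightarrow> [F $ n = G $ n] (mod int p)"
proof -
  assume "fcong F G"
  then obtain K where "F - G = of_nat p * K" by (auto simp: fcong_def dvd_def)
  hence "(F - G) $ n = int p * K $ n" by (simp flip: fps_of_nat)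
  thus ?thesis by (simp add: cong_iff_dvd_diff)
qed

text \<open>Modulo \<open>p\<close>, the \<open>p\<close>-th power of a series is a constant up to terms of degree at least \<open>p\<close>.\<close>

lemma power_p_coeff:
  fixes W :: "int fps"
  assumes "0 < i" "i < p"
  shows "int p dvd (W ^ p) $ i"
proof -
  have "fps_deriv (W ^ p) $ (i - 1) = int p * (fps_deriv W * W ^ (p - 1)) $ (i - 1)"
    by (simp add: fps_deriv_power mult.assoc)
  hence "int p dvd int i * (W ^ p) $ i" using assms(1) by simp
  moreover have "\<not> int p dvd int i" using assms by (intro not_dvd_small) auto
  ultimately show ?thesis using prime_dvd_mult_iff[OF prime_int_p] by blast
qed

lemma coeff_mult_power_p: "[(F * W ^ p) $ (p - 1) = F $ (p - 1) * (W $ 0) ^ p] (mod int p)"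
proof -
  have "(F * W ^ p) $ (p - 1) = (\<Sum>i=0..p-1. F $ i * (W ^ p) $ (p - 1 - i))" by (rule fps_mult_nth)
  also have "[\<dots> = (\<Sum>i=0..p-1. if i = p - 1 then F $ i * (W $ 0) ^ p else 0)] (mod int p)"
  proof (rule cong_sum)
    fix i assume "i \<in> {0..p-1}"
    thus "[F $ i * (W ^ p) $ (p - 1 - i) = (if i = p - 1 then F $ i * (W $ 0) ^ p else 0)] (mod int p)"
      using power_p_coeff[of "p - 1 - i" W] by (auto simp: fps_power_zeroth cong_0_iff)
  qed
  also have "(\<Sum>i=0..p-1. if i = p - 1 then F $ i * (W $ 0) ^ p else 0) = F $ (p - 1) * (W $ 0) ^ p"
    by (subst sum.delta) auto
  finally show ?thesis .
qed

lemma p_pos_le: "1 \<le> p" using p_gt_2 by simp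

text \<open>The coefficient of degree \<open>p - 1\<close> plays the role of the Cartier operator on the differential
  \<open>h(r) dr\<close>. The differentials \<open>r^i dr\<close> with \<open>i + 1\<close> prime to \<open>p\<close> are exact and contribute nothing.\<close>

lemma compose_deriv_coeff:
  fixes h r :: "int fps"
  assumes r0: "r $ 0 = 0"
  shows "[((h oo r) * fps_deriv r) $ (p - 1) = h $ (p - 1) * (r $ 1) ^ p] (mod int p)"
proof -
  have prefix: "(r ^ i) $ n = 0" if "n < i" for i n using startsby_zero_power_prefix[OF r0] that by blast
  have "((h oo r) * fps_deriv r) $ (p - 1)
      = (\<Sum>n=0..p-1. (\<Sum>i=0..p-1. h $ i * (r ^ i) $ n) * fps_deriv r $ (p - 1 - n))"
    unfolding fps_mult_nth fps_compose_nth
    by (intro sum.cong refl arg_cong2[of _ _ _ _ "(*)"] sum.mono_neutral_left) (auto simp: prefix)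
  also have "\<dots> = (\<Sum>n=0..p-1. \<Sum>i=0..p-1. h $ i * ((r ^ i) $ n * fps_deriv r $ (p - 1 - n)))"
    by (simp add: sum_distrib_right mult.assoc)
  also have "\<dots> = (\<Sum>i=0..p-1. \<Sum>n=0..p-1. h $ i * ((r ^ i) $ n * fps_deriv r $ (p - 1 - n)))"
    by (rule sum.swap)
  also have "\<dots> = (\<Sum>i=0..p-1. h $ i * (r ^ i * fps_deriv r) $ (p - 1))"
    by (simp add: sum_distrib_left fps_mult_nth)
  also have "[\<dots> = (\<Sum>i=0..p-1. if i = p - 1 then h $ i * (r $ 1) ^ p else 0)] (mod int p)"
  proof (rule cong_sum)
    fix i assume i: "i \<in> {0..p-1}"
    show "[h $ i * (r ^ i * fps_deriv r) $ (p - 1) = (if i = p - 1 then h $ i * (r $ 1) ^ p else 0)] (mod int p)"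
    proof (cases "i = p - 1")
      case True
      have "(r ^ (p - 1) * fps_deriv r) $ (p - 1) = (\<Sum>n=0..p-1. if n = p - 1 then (r $ 1) ^ p else 0)"
        unfolding fps_mult_nth
      proof (intro sum.cong refl)
        fix n assume "n \<in> {0..p-1}"
        moreover have "(r $ 1) ^ (p - 1) * r $ 1 = (r $ 1) ^ p" using p_gt_2 by (simp flip: power_Suc2)
        ultimately show "(r ^ (p - 1)) $ n * fps_deriv r $ (p - 1 - n) = (if n = p - 1 then (r $ 1) ^ p else 0)"
          using prefix[of n "p - 1"] startsby_zero_power_nth_same[OF r0, of "p - 1"] by auto
      qed
      thus ?thesis using True by simp
    next
      case False
      hence "Suc i < p" using i p_gt_2 by auto
      have "fps_deriv (r ^ Suc i) = of_nat (Suc i) * (fps_deriv r * r ^ i)"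
        using fps_deriv_power'[of r "Suc i"] by (simp only: diff_Suc_1 mult.assoc)
      hence "fps_deriv (r ^ Suc i) $ (p - 1) = int (Suc i) * (r ^ i * fps_deriv r) $ (p - 1)"
        by (simp only: fps_of_nat[symmetric] fps_mult_left_const_nth mult.commute)
      moreover have "fps_deriv (r ^ Suc i) $ (p - 1) = int p * (r ^ Suc i) $ p"
        by (simp only: fps_deriv_nth le_add_diff_inverse2 p_pos_le)
      ultimately have "int p dvd int (Suc i) * (r ^ i * fps_deriv r) $ (p - 1)" by (metis dvd_triv_left)
      moreover have "\<not> int p dvd int (Suc i)" using \<open>Suc i < p\<close> by (intro not_dvd_small) auto
      ultimately have "int p dvd (r ^ i * fps_deriv r) $ (p - 1)" using prime_dvd_mult_iff[OF prime_int_p] by blast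
      thus ?thesis using False by (simp add: cong_0_iff)
    qed
  qed
  also have "(\<Sum>i=0..p-1. if i = p - 1 then h $ i * (r $ 1) ^ p else 0) = h $ (p - 1) * (r $ 1) ^ p"
    by (subst sum.delta) auto
  finally show ?thesis .
qed

text \<open>Let \<open>(X, Y) \<mapsto> (r(X), r'(X) Y)\<close> map \<open>Y^2 = f(X)\<close> to \<open>Y^2 = g(X)\<close>, so that it pulls back \<open>dX / Y\<close> to
  \<open>dX / Y\<close>, and let it fix the origin. Then
  \<open>g(r)^m r' \<equiv> f^m r'^p\<close>, where \<open>r'^p\<close> is constant up to degree \<open>p\<close>, and comparing the
  coefficients of degree \<open>p - 1\<close> gives the equality of the Hasse invariants.\<close>

lemma hasse_invariant_isogeny:
  fixes f g r :: "int fps"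
  assumes r0: "r $ 0 = 0" and r1: "\<not> int p dvd r $ 1"
    and fg: "fcong (g oo r) (f * fps_deriv r ^ 2)"
  shows "[(g ^ m) $ (p - 1) = (f ^ m) $ (p - 1)] (mod int p)"
proof -
  let ?w = "fps_deriv r"
  have "[(g ^ m) $ (p - 1) * (r $ 1) ^ p = ((g ^ m oo r) * ?w) $ (p - 1)] (mod int p)"
    by (rule cong_sym[OF compose_deriv_coeff[OF r0]])
  also have "g ^ m oo r = (g oo r) ^ m" by (rule fps_compose_power[OF r0, symmetric])
  also have "[((g oo r) ^ m * ?w) $ (p - 1) = ((f * ?w ^ 2) ^ m * ?w) $ (p - 1)] (mod int p)"
    by (intro fcong_nth fcong_mult_right fcong_power fg)
  also have "(f * ?w ^ 2) ^ m * ?w = f ^ m * ?w ^ (2 * m + 1)"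
    by (simp only: power_mult_distrib power_mult power_add power_one_right mult.assoc)
  also have "2 * m + 1 = p" by (rule p_eq[symmetric])
  also have "[(f ^ m * ?w ^ p) $ (p - 1) = (f ^ m) $ (p - 1) * (?w $ 0) ^ p] (mod int p)"
    by (rule coeff_mult_power_p)
  finally have "[(r $ 1) ^ p * (g ^ m) $ (p - 1) = (r $ 1) ^ p * (f ^ m) $ (p - 1)] (mod int p)"
    by (simp add: mult.commute)
  thus ?thesis using cong_mult_cancel r1 prime_dvd_power[OF prime_int_p] by blast
qed

section \<open>The Hasse invariant as a truncated hypergeometric sum\<close>

text \<open>The Hasse invariant of the curve \<open>Y^2 = X (X^2 + a X + b)\<close>, that is, the coefficient of degree
  \<open>p - 1\<close> in the \<open>m\<close>-th power of the cubic.\<close>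

definition H :: "int \<Rightarrow> int \<Rightarrow> int" where "H a b = coeff ([:b, a, 1:] ^ m) m"

lemma H_eq_cubic: "((fps_X * (fps_X ^ 2 + of_int a * fps_X + of_int b)) ^ m) $ (p - 1) = H a b"
proof -
  have "fps_X ^ 2 + of_int a * fps_X + of_int b = fps_of_poly [:b, a, 1:]"
    by (simp add: fps_of_poly_pCons power2_eq_square algebra_simps flip: fps_of_int)
  moreover have "p - 1 = m + m" using p_eq by simp
  ultimately show ?thesis
    by (simp add: power_mult_distrib H_def fps_X_power_mult_nth flip: fps_of_poly_power)
qed

lemma H_eq_sum: "H a b = (\<Sum>k\<le>m. int (m choose (2 * k)) * int ((2 * k) choose k) * a ^ (m - 2 * k) * b ^ k)"
proof -
  have "[:b, a, 1:] = [:b:] + monom 1 1 * [:a, 1:]" by (simp add: monom_altdef)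
  hence "[:b, a, 1:] ^ m = (\<Sum>k\<le>m. of_nat (m choose k) * [:b:] ^ k * (monom 1 1 * [:a, 1:]) ^ (m - k))"
    by (simp only: binomial_ring)
  hence "H a b = (\<Sum>k\<le>m. coeff (of_nat (m choose k) * [:b:] ^ k * (monom 1 1 * [:a, 1:]) ^ (m - k)) m)"
    by (simp only: H_def coeff_sum)
  also have "\<dots> = (\<Sum>k\<le>m. int (m choose (2 * k)) * int ((2 * k) choose k) * a ^ (m - 2 * k) * b ^ k)"
  proof (rule sum.cong[OF refl])
    fix k assume k: "k \<in> {..m}"
    have "of_nat (m choose k) * [:b:] ^ k * (monom 1 1 * [:a, 1:]) ^ (m - k)
        = smult (int (m choose k) * b ^ k) (monom 1 (m - k) * [:a, 1:] ^ (m - k))"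
    proof -
      have "(monom 1 1 * [:a, 1:]) ^ (m - k) = monom 1 (m - k) * [:a, 1:] ^ (m - k)"
        by (simp only: power_mult_distrib monom_power) simp
      moreover have "of_nat (m choose k) * [:b:] ^ k = [:int (m choose k) * b ^ k:]"
        by (simp add: of_nat_poly poly_const_pow)
      ultimately show ?thesis by (simp only: mult_pCons_left smult_0_left) simp
    qed
    hence "coeff (of_nat (m choose k) * [:b:] ^ k * (monom 1 1 * [:a, 1:]) ^ (m - k)) m
        = int (m choose k) * b ^ k * coeff ([:a, 1:] ^ (m - k)) k"
      using k by (simp add: coeff_monom_mult)
    also have "coeff ([:a, 1:] ^ (m - k)) k = int ((m - k) choose k) * a ^ (m - 2 * k)"
    proof (cases "k \<le> m - k")
      case True
      thus ?thesis using coeff_linear_poly_power[OF True, of a 1] by (simp add: mult_2)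
    next
      case False
      have "degree ([:a, 1:] ^ (m - k)) \<le> m - k" using degree_power_le[of "[:a, 1:]" "m - k"] by simp
      thus ?thesis using False by (simp add: coeff_eq_0 binomial_eq_0)
    qed
    also have "int (m choose k) * b ^ k * (int ((m - k) choose k) * a ^ (m - 2 * k))
        = int ((m choose k) * ((m - k) choose k)) * a ^ (m - 2 * k) * b ^ k" by simp
    also have "(m choose k) * ((m - k) choose k) = (m choose (2 * k)) * ((2 * k) choose k)"
    proof (cases "2 * k \<le> m")
      case True
      thus ?thesis using choose_mult[of k "2 * k" m] by (simp add: mult_2)
    qed (simp add: binomial_eq_0)
    finally show "coeff (of_nat (m choose k) * [:b:] ^ k * (monom 1 1 * [:a, 1:]) ^ (m - k)) m
        = int (m choose (2 * k)) * int ((2 * k) choose k) * a ^ (m - 2 * k) * b ^ k" by simp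
  qed
  finally show ?thesis .
qed

lemma central_binomial_cong:
  "j \<le> m \<Longrightarrow> [int (m choose j) * (-4) ^ j = int ((2 * j) choose j)] (mod int p)"
proof (induction j)
  case (Suc j)
  have r1: "int (Suc j) * int (m choose Suc j) = (int m - int j) * int (m choose j)"
  proof -
    have "Suc j * (m choose Suc j) = (m - j) * (m choose j)"
      using binomial_absorption[of j m] binomial_absorb_comp[of m j] by simp
    hence "int (Suc j * (m choose Suc j)) = int ((m - j) * (m choose j))" by (rule arg_cong)
    thus ?thesis using Suc.prems by (simp only: of_nat_mult of_nat_diff[OF Suc_leD])
  qed
  have r2: "int (Suc j) * int ((2 * Suc j) choose Suc j) = (4 * int j + 2) * int ((2 * j) choose j)"
  proof -
    have "int (Suc j * ((2 * Suc j) choose Suc j)) = int ((4 * j + 2) * ((2 * j) choose j))"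
      by (rule arg_cong[OF central_binomial_Suc])
    thus ?thesis by (simp only: of_nat_mult of_nat_add of_nat_numeral)
  qed
  have "int (Suc j) * (int (m choose Suc j) * (-4) ^ Suc j) = (- 4 * (int m - int j)) * (int (m choose j) * (-4) ^ j)"
  proof -
    have "int (Suc j) * (int (m choose Suc j) * (-4) ^ Suc j) = (int (Suc j) * int (m choose Suc j)) * ((-4) * (-4) ^ j)"
      by (simp only: power_Suc ac_simps)
    also have "\<dots> = ((int m - int j) * int (m choose j)) * ((-4) * (-4) ^ j)" by (simp only: r1)
    also have "\<dots> = (- 4 * (int m - int j)) * (int (m choose j) * (-4) ^ j)" by (simp only: ac_simps)
    finally show ?thesis .
  qed
  also have "[\<dots> = (4 * int j + 2) * int ((2 * j) choose j)] (mod int p)"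
  proof (rule cong_mult)
    have "- 4 * (int m - int j) - (4 * int j + 2) = int p * (-2)"
    proof -
      have "int p = int (2 * m + 1)" using p_eq by (rule arg_cong)
      thus ?thesis by simp
    qed
    thus "[- 4 * (int m - int j) = 4 * int j + 2] (mod int p)" unfolding cong_iff_dvd_diff by (metis dvd_triv_left)
    show "[int (m choose j) * (-4) ^ j = int ((2 * j) choose j)] (mod int p)" using Suc by simp
  qed
  also have "(4 * int j + 2) * int ((2 * j) choose j) = int (Suc j) * int ((2 * Suc j) choose Suc j)"
    by (rule r2[symmetric])
  finally have "[int (Suc j) * (int (m choose Suc j) * (-4) ^ Suc j) = int (Suc j) * int ((2 * Suc j) choose Suc j)] (mod int p)" .
  moreover have "\<not> int p dvd int (Suc j)" using Suc.prems p_eq by (intro not_dvd_small) auto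
  ultimately show ?case using cong_mult_cancel by blast
qed simp

text \<open>Since \<open>2 m \<equiv> -1\<close>, the number \<open>(m choose 2k) 16^k\<close> is congruent to \<open>(4k choose 2k)\<close>. The terms with
  \<open>2 k > m\<close> vanish on both sides.\<close>

lemma H_cong_hypergeometric:
  assumes b: "[b = 16 * a ^ 2 * x] (mod int p)"
  shows "[H a b = a ^ m * (\<Sum>k<p. acoeff k * x ^ k)] (mod int p)"
proof -
  have H: "H a b = (\<Sum>k<p. int (m choose (2 * k)) * int ((2 * k) choose k) * a ^ (m - 2 * k) * b ^ k)"
    unfolding H_eq_sum using p_eq by (intro sum.mono_neutral_left) auto
  have "[(\<Sum>k<p. int (m choose (2 * k)) * int ((2 * k) choose k) * a ^ (m - 2 * k) * b ^ k)
      = (\<Sum>k<p. a ^ m * (int ((2 * k) choose k) * int ((4 * k) choose (2 * k)) * x ^ k))] (mod int p)"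
  proof (rule cong_sum)
    fix k assume k: "k \<in> {..<p}"
    show "[int (m choose (2 * k)) * int ((2 * k) choose k) * a ^ (m - 2 * k) * b ^ k
        = a ^ m * (int ((2 * k) choose k) * int ((4 * k) choose (2 * k)) * x ^ k)] (mod int p)"
    proof (cases "2 * k \<le> m")
      case True
      have "[int (m choose (2 * k)) * int ((2 * k) choose k) * a ^ (m - 2 * k) * b ^ k
          = int (m choose (2 * k)) * int ((2 * k) choose k) * a ^ (m - 2 * k) * (16 * a ^ 2 * x) ^ k] (mod int p)"
        by (intro cong_mult cong_refl cong_pow b)
      also have "int (m choose (2 * k)) * int ((2 * k) choose k) * a ^ (m - 2 * k) * (16 * a ^ 2 * x) ^ k
          = int (m choose (2 * k)) * (-4) ^ (2 * k) * (int ((2 * k) choose k) * (a ^ (m - 2 * k) * a ^ (2 * k)) * x ^ k)"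
        by (simp add: power_mult_distrib power_mult)
      also have "a ^ (m - 2 * k) * a ^ (2 * k) = a ^ m" using True by (simp flip: power_add)
      also have "[int (m choose (2 * k)) * (-4) ^ (2 * k) * (int ((2 * k) choose k) * a ^ m * x ^ k)
          = int ((2 * (2 * k)) choose (2 * k)) * (int ((2 * k) choose k) * a ^ m * x ^ k)] (mod int p)"
        by (intro cong_mult cong_refl central_binomial_cong True)
      finally show ?thesis by (simp add: ac_simps)
    next
      case False
      have "p dvd ((2 * k) choose k) * ((4 * k) choose (2 * k))"
      proof (cases "2 * k < p")
        case True
        thus ?thesis using False p_eq prime_dvd_choose[OF p_prime, of "4 * k" "2 * k"] by simp
      next
        case False
        thus ?thesis using k prime_dvd_choose[OF p_prime, of "2 * k" k] by simp
      qed
      hence "int p dvd int (((2 * k) choose k) * ((4 * k) choose (2 * k)))" by (rule of_nat_dvd_iff[THEN iffD2])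
      hence "int p dvd a ^ m * (int ((2 * k) choose k) * int ((4 * k) choose (2 * k)) * x ^ k)"
        by (simp only: of_nat_mult) (rule dvd_mult, rule dvd_mult2)
      thus ?thesis using False by (simp add: binomial_eq_0 cong_iff_dvd_diff)
    qed
  qed
  thus ?thesis unfolding H acoeff_def sum_distrib_left .
qed

section \<open>The 3-isogeny\<close>

text \<open>The 3-isogeny \<open>r = q^2 x (x - 2 q)^2 / (1 - q x)^2\<close>, obtained from Velu's formulas for the subgroup
  of order \<open>3\<close> with first coordinate \<open>1 / q\<close>, moved so that it fixes the origin. The variable \<open>V\<close> stands for the
  inverse of \<open>1 - q x\<close>, and the relation \<open>2 q^2 = 4 q + 1\<close> is kept as a divisor. The
  element \<open>K\<close> is the cofactor found by polynomial division.\<close>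

lemma isogeny_identity:
  fixes x q V :: "'a :: idom"
  assumes V: "(1 - q * x) * V = 1"
  defines "A \<equiv> x - 2 * q" and "B \<equiv> 1 - q * x"
  defines "C \<equiv> A * B + 2 * x * B + 2 * q * x * A"
  defines "r \<equiv> q ^ 2 * x * A ^ 2 * V ^ 2" and "r' \<equiv> q ^ 2 * A * C * V ^ 3"
  shows "2 * q ^ 2 - 4 * q - 1 dvd r * (r ^ 2 + 28 * r + (18 + 80 * q)) - (x * (x ^ 2 + 4 * x + 2)) * r' ^ 2"
proof -
  define K where "K = (- 18 - 8 * q - 4 * q ^ 2) + (72 * q + 32 * q ^ 2 - 8 * q ^ 3) * x
    + (- 90 * q ^ 2 - 56 * q ^ 3 + 32 * q ^ 4 + 16 * q ^ 5 + 8 * q ^ 6) * x ^ 2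
    + (8 * q ^ 2 + 16 * q ^ 3 + 16 * q ^ 4 - 16 * q ^ 5) * x ^ 3
    + (9 * q ^ 2 - 4 * q ^ 3 + 10 * q ^ 4) * x ^ 4 - 6 * q ^ 3 * x ^ 5"
  have BV: "B * V = 1" using V by (simp add: B_def)
  have "r = q ^ 2 * x * A ^ 2 * V ^ 2 * (B * V) ^ 4" by (simp add: BV r_def)
  also have "\<dots> = q ^ 2 * x * A ^ 2 * V ^ 6 * B ^ 4" by (simp add: ac_simps eval_nat_numeral)
  finally have r1: "r = q ^ 2 * x * A ^ 2 * V ^ 6 * B ^ 4" .
  have "r ^ 2 = q ^ 4 * x ^ 2 * A ^ 4 * V ^ 4 * (B * V) ^ 2"
    by (simp add: BV r_def power_mult_distrib flip: power_mult)
  also have "\<dots> = q ^ 4 * x ^ 2 * A ^ 4 * V ^ 6 * B ^ 2" by (simp add: ac_simps eval_nat_numeral)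
  finally have r2: "r ^ 2 = q ^ 4 * x ^ 2 * A ^ 4 * V ^ 6 * B ^ 2" .
  have r3: "r * r ^ 2 = q ^ 6 * x ^ 3 * A ^ 6 * V ^ 6"
    unfolding r_def by (simp add: ac_simps eval_nat_numeral)
  have r4: "r' ^ 2 = q ^ 4 * A ^ 2 * C ^ 2 * V ^ 6"
    unfolding r'_def by (simp add: ac_simps eval_nat_numeral)
  have K: "q ^ 4 * x ^ 2 * A ^ 4 + 28 * (q ^ 2 * x * A ^ 2 * B ^ 2) + (18 + 80 * q) * B ^ 4
      - (x ^ 2 + 4 * x + 2) * q ^ 2 * C ^ 2 = (2 * q ^ 2 - 4 * q - 1) * K"
    unfolding A_def B_def C_def K_def
    by (simp add: algebra_simps power2_eq_square power3_eq_cube eval_nat_numeral)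
  have "r * (r ^ 2 + 28 * r + (18 + 80 * q)) - (x * (x ^ 2 + 4 * x + 2)) * r' ^ 2
      = r * r ^ 2 + 28 * r ^ 2 + (18 + 80 * q) * r - (x * (x ^ 2 + 4 * x + 2)) * r' ^ 2"
    by (simp add: algebra_simps power2_eq_square)
  also have "\<dots> = q ^ 2 * x * A ^ 2 * V ^ 6 * (q ^ 4 * x ^ 2 * A ^ 4 + 28 * (q ^ 2 * x * A ^ 2 * B ^ 2)
      + (18 + 80 * q) * B ^ 4 - (x ^ 2 + 4 * x + 2) * q ^ 2 * C ^ 2)"
    unfolding r3 r4 unfolding r2 unfolding r1 by (simp add: algebra_simps eval_nat_numeral)
  finally show ?thesis unfolding K by simp
qed

lemma H_isogeny:
  fixes q :: int
  assumes q: "[2 * q ^ 2 = 4 * q + 1] (mod int p)"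
  shows "[H 28 (18 + 80 * q) = H 4 2] (mod int p)"
proof -
  define V :: "int fps" where "V = Abs_fps (\<lambda>n. q ^ n)"
  define Q :: "int fps" where "Q = of_int q"
  define A where "A = fps_X - 2 * Q"
  define B where "B = 1 - Q * fps_X"
  define C where "C = A * B + 2 * fps_X * B + 2 * Q * fps_X * A"
  define r where "r = Q ^ 2 * fps_X * A ^ 2 * V ^ 2"
  let ?f = "fps_X * (fps_X ^ 2 + of_int 4 * fps_X + of_int 2) :: int fps"
  let ?g = "fps_X * (fps_X ^ 2 + of_int 28 * fps_X + of_int (18 + 80 * q)) :: int fps"
  have Qc: "Q = fps_const q" by (simp add: Q_def flip: fps_of_int)
  have BV: "(1 - Q * fps_X) * V = 1"
  proof (rule fps_ext)
    fix n show "((1 - Q * fps_X) * V) $ n = 1 $ n"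
      by (cases n) (simp_all add: Qc V_def left_diff_distrib mult.assoc)
  qed
  have dB: "fps_deriv B = - Q" by (simp add: B_def Qc)
  have dA: "fps_deriv A = 1" by (simp add: A_def Qc)
  have dQ: "fps_deriv Q = 0" by (simp add: Qc)
  have dV: "fps_deriv V = Q * V ^ 2"
  proof -
    have "fps_deriv (B * V) = 0" using BV by (simp add: B_def)
    hence e: "B * fps_deriv V = Q * V" by (simp add: dB algebra_simps)
    have "fps_deriv V = (B * V) * fps_deriv V" using BV by (simp add: B_def)
    also have "\<dots> = V * (B * fps_deriv V)" by (simp only: ac_simps)
    finally show ?thesis unfolding e by (simp add: power2_eq_square ac_simps)
  qed
  have dr: "fps_deriv r = Q ^ 2 * A * C * V ^ 3"
  proof -
    have "fps_deriv r = Q ^ 2 * (A ^ 2 * V ^ 2 + 2 * fps_X * A * V ^ 2 + 2 * fps_X * A ^ 2 * Q * V ^ 3)"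
      by (simp add: r_def fps_deriv_power' dA dQ dV power2_eq_square power3_eq_cube algebra_simps)
    also have "\<dots> = Q ^ 2 * (A ^ 2 * V ^ 2 * (B * V) + 2 * fps_X * A * V ^ 2 * (B * V) + 2 * fps_X * A ^ 2 * Q * V ^ 3)"
      using BV by (simp add: B_def)
    also have "\<dots> = Q ^ 2 * A * C * V ^ 3"
      unfolding C_def by (simp add: power2_eq_square power3_eq_cube algebra_simps)
    finally show ?thesis .
  qed
  have r0: "r $ 0 = 0" by (simp add: r_def)
  have "r $ 1 = fps_deriv r $ 0" by simp
  also have "\<dots> = 4 * q ^ 4" by (simp add: dr C_def A_def B_def Qc V_def power4_eq_xxxx power2_eq_square fps_power_zeroth)
  finally have r1: "r $ 1 = 2 ^ 2 * q ^ 4" by simp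
  have nq: "\<not> int p dvd q"
  proof
    assume "int p dvd q"
    hence "int p dvd 2 * q ^ 2 - 4 * q" by (simp add: power2_eq_square)
    moreover have "int p dvd 2 * q ^ 2 - (4 * q + 1)" using q by (simp add: cong_iff_dvd_diff)
    ultimately have "int p dvd (2 * q ^ 2 - 4 * q) - (2 * q ^ 2 - (4 * q + 1))" by (rule dvd_diff)
    thus False using p_gt_2 by simp
  qed
  obtain e where e: "2 * q ^ 2 - 4 * q - 1 = int p * e"
    using q by (auto simp: cong_iff_dvd_diff dvd_def algebra_simps)
  have "?g oo r = r * (r ^ 2 + 28 * r + (18 + 80 * Q))"
  proof -
    have "of_int (18 + 80 * q) = 18 + 80 * Q" by (simp add: Q_def)
    moreover have "Q oo r = Q" by (simp add: Qc)
    ultimately show ?thesis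
      using r0 by (simp add: fps_compose_mult_distrib fps_compose_add_distrib fps_compose_power[symmetric])
  qed
  hence "fcong (?g oo r) (?f * fps_deriv r ^ 2)"
  proof -
    assume g: "?g oo r = r * (r ^ 2 + 28 * r + (18 + 80 * Q))"
    have "2 * Q ^ 2 - 4 * Q - 1 = of_int (2 * q ^ 2 - 4 * q - 1)" by (simp add: Q_def)
    also have "\<dots> = of_nat p * of_int e" unfolding e by simp
    finally have "of_nat p dvd 2 * Q ^ 2 - 4 * Q - 1" by simp
    from dvd_trans[OF this isogeny_identity[OF BV, folded A_def, folded B_def, folded C_def r_def, folded dr]]
    show ?thesis unfolding fcong_def g by simp
  qed
  moreover have "\<not> int p dvd r $ 1"
    unfolding r1 using not_dvd_mult[OF not_dvd_power2[of 2], of "q ^ 4"] nq prime_dvd_power[OF prime_int_p, of q 4] by blast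
  ultimately have "[(?g ^ m) $ (p - 1) = (?f ^ m) $ (p - 1)] (mod int p)"
    using hasse_invariant_isogeny[OF r0] by blast
  thus ?thesis unfolding H_eq_cubic .
qed

lemma int_p_eq: "int p = 2 * int m + 1"
  by (metis p_eq of_nat_add of_nat_mult of_nat_numeral of_nat_1)

section \<open>Representations by the form\<close>

text \<open>The norm equation for the family reads \<open>4 A^2 + 2 c^2 = 16 p\<close> for the cubic sum \<open>A\<close>, and the factors of
  \<open>2\<close> are removed one at a time.\<close>

lemma cubic_sum_norm_equation:
  assumes "chi (-2) = 1"
  shows "\<exists>a b. int p = a ^ 2 + 2 * b ^ 2 \<and> cubic_sum = 2 * a"
proof -
  have "line_sum 1 = 2 * cubic_sum"
  proof -
    have "gre (1 * GI t 1 ^ 4) * (t ^ 2 + 1) = (t ^ 2 + 1) * (t ^ 4 - 6 * t ^ 2 + 1)" for t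
      by (simp add: power4_eq_xxxx power2_eq_square algebra_simps)
    thus ?thesis unfolding line_sum_def using sextic_sum[OF assms] by (simp only: gint_sel(3) chi_1)
  qed
  moreover obtain c where "line_sum 1 ^ 2 + 2 * c ^ 2 = 16 * int p" using line_sum_norm_equation[OF assms] by blast
  ultimately have 1: "2 * cubic_sum ^ 2 + c ^ 2 = 8 * int p" by (simp add: power_mult_distrib)
  hence "c ^ 2 = 2 * (4 * int p - cubic_sum ^ 2)" by simp
  hence "even (c ^ 2)" by (metis dvd_triv_left)
  then obtain d where d: "c = 2 * d" by (auto elim: evenE)
  have 2: "cubic_sum ^ 2 + 2 * d ^ 2 = 4 * int p" using 1 unfolding d by (simp add: power_mult_distrib)
  hence "cubic_sum ^ 2 = 2 * (2 * int p - d ^ 2)" by simp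
  hence "even (cubic_sum ^ 2)" by (metis dvd_triv_left)
  then obtain a where a: "cubic_sum = 2 * a" by (auto elim: evenE)
  have 3: "2 * a ^ 2 + d ^ 2 = 2 * int p" using 2 unfolding a by (simp add: power_mult_distrib)
  hence "d ^ 2 = 2 * (int p - a ^ 2)" by simp
  hence "even (d ^ 2)" by (metis dvd_triv_left)
  then obtain b where b: "d = 2 * b" by (auto elim: evenE)
  have "int p = a ^ 2 + 2 * b ^ 2" using 3 unfolding b by (simp add: power_mult_distrib)
  thus ?thesis using a by blast
qed

text \<open>One of \<open>a y - x b\<close> and \<open>a y + x b\<close> is divisible by \<open>p\<close>, and by the composition formula for the form its
  square is at most \<open>p^2 / 2\<close>; hence it vanishes.\<close>

lemma representation_unique:
  assumes ab: "int p = a ^ 2 + 2 * b ^ 2" and xy: "int p = x ^ 2 + 2 * y ^ 2"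
  shows "x ^ 2 = (a :: int) ^ 2"
proof -
  have *: "x ^ 2 = a ^ 2" if d: "int p dvd a * y - x * b" and xy: "int p = x ^ 2 + 2 * y ^ 2" for x y
  proof -
    obtain k where k: "a * y - x * b = int p * k" using d by blast
    \<comment> \<open>Composition of the form with itself\<close>
    have "int p ^ 2 = (a * x + 2 * b * y) ^ 2 + 2 * (a * y - x * b) ^ 2"
    proof -
      have "int p ^ 2 = (a ^ 2 + 2 * b ^ 2) * (x ^ 2 + 2 * y ^ 2)" using ab xy by (simp add: power2_eq_square)
      thus ?thesis by (simp add: power2_eq_square algebra_simps)
    qed
    hence "2 * (a * y - x * b) ^ 2 \<le> int p ^ 2" by simp
    hence "2 * (int p ^ 2 * k ^ 2) \<le> int p ^ 2" unfolding k by (simp add: power_mult_distrib)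
    hence "int p ^ 2 * (2 * k ^ 2) \<le> int p ^ 2 * 1" by simp
    hence "2 * k ^ 2 \<le> 1" using p_gt_2 by (subst (asm) mult_le_cancel_left_pos) auto
    hence "k = 0" by (smt (verit) zero_less_power2)
    hence "a * y = x * b" using k by simp
    hence "a ^ 2 * (2 * y ^ 2) = x ^ 2 * (2 * b ^ 2)" by (metis power_mult_distrib mult.left_commute)
    moreover have "2 * y ^ 2 = int p - x ^ 2" "2 * b ^ 2 = int p - a ^ 2" using ab xy by simp_all
    ultimately have "a ^ 2 * (int p - x ^ 2) = x ^ 2 * (int p - a ^ 2)" by simp
    hence "int p * a ^ 2 = int p * x ^ 2" by (simp add: algebra_simps)
    thus ?thesis using p_gt_2 by simp
  qed
  have "(a * y - x * b) * (a * y - (- x) * b) = a ^ 2 * y ^ 2 - x ^ 2 * b ^ 2"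
    by (simp add: power2_eq_square algebra_simps)
  also have "\<dots> = (a ^ 2 + 2 * b ^ 2) * y ^ 2 - (x ^ 2 + 2 * y ^ 2) * b ^ 2" by (simp add: algebra_simps)
  also have "\<dots> = int p * (y ^ 2 - b ^ 2)" unfolding ab[symmetric] xy[symmetric] by (simp add: algebra_simps)
  finally have "int p dvd (a * y - x * b) * (a * y - (- x) * b)" by simp
  hence "int p dvd a * y - x * b \<or> int p dvd a * y - (- x) * b" using prime_dvd_mult_iff[OF prime_int_p] by blast
  thus ?thesis using *[of y x] *[of y "- x"] xy by auto
qed

section \<open>Values of the quadratic character\<close>

lemma chi_minus_1: "chi (-1) = (-1) ^ m"
  by (rule sign_eqI[OF chi_euler]) (auto simp: abs_chi power_abs)

text \<open>By Gauss's lemma: the multiples \<open>2 x\<close> with \<open>0 < x \<le> m\<close> that exceed \<open>m\<close> are counted.\<close>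

lemma chi_2: "chi 2 = (-1) ^ (m - m div 2)"
proof -
  interpret gs: GAUSS p 2
    by unfold_locales (use p_prime p_gt_2 not_dvd_2 in \<open>auto simp: cong_0_iff\<close>)
  have half: "(int p - 1) div 2 = int m" using int_p_eq by simp
  have C: "gs.C = (\<lambda>x. 2 * x) ` {0<..int m}"
    unfolding gs.C_def gs.B_def gs.A_def half image_image
    by (rule image_cong) (use int_p_eq in auto)
  have "gs.E = (\<lambda>x. 2 * x) ` {int (m div 2)<..int m}"
    unfolding gs.E_def C half by (auto simp: image_iff)
  hence "card gs.E = m - m div 2" by (simp add: card_image inj_on_def nat_diff_distrib)
  thus ?thesis using gs.gauss_lemma by (simp add: chi_def)
qed

lemma chi_3:
  assumes "p \<noteq> 3"
  shows "chi 3 * Legendre (int p) 3 = (-1) ^ m"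
  using Quadratic_Reciprocity[of 3 p] assms p_prime p_gt_2 by (simp add: chi_def m_def)

lemma Legendre_3: "Legendre a 3 = (if a mod 3 = 0 then 0 else if a mod 3 = 1 then 1 else -1)"
proof -
  have sq: "y ^ 2 mod 3 = 0 \<or> y ^ 2 mod 3 = 1" for y :: int
  proof -
    have "y mod 3 = 0 \<or> y mod 3 = 1 \<or> y mod 3 = 2" by presburger
    thus ?thesis by (subst (1 2) power_mod[symmetric]) auto
  qed
  have "QuadRes 3 a \<longleftrightarrow> a mod 3 = 0 \<or> a mod 3 = 1"
  proof
    assume "QuadRes 3 a"
    then obtain y where "y ^ 2 mod 3 = a mod 3" by (auto simp: QuadRes_def cong_def)
    thus "a mod 3 = 0 \<or> a mod 3 = 1" using sq[of y] by simp
  next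
    assume "a mod 3 = 0 \<or> a mod 3 = 1"
    thus "QuadRes 3 a"
      unfolding QuadRes_def cong_def by (auto intro: exI[of _ 0] exI[of _ 1])
  qed
  thus ?thesis by (auto simp: Legendre_def cong_def)
qed

lemma int_p_mod_3: "int p mod 3 = int (p mod 24 mod 3)"
  by (simp add: zmod_int mod_mod_cancel)

lemma chi_values_mod_24:
  shows "p mod 24 \<in> {1, 19} \<Longrightarrow> chi (-2) = 1 \<and> chi 6 = 1"
    and "p mod 24 \<in> {5, 23} \<Longrightarrow> chi (-2) = -1 \<and> chi 6 = 1"
proof -
  define j where "j = p div 24"
  have pj: "p = 24 * j + p mod 24" by (simp add: j_def)
  have chi2: "chi (-2) = chi (-1) * chi 2" "chi 6 = chi 2 * chi 3"
    using chi_mult[of "-1" 2] chi_mult[of 2 3] by simp_all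
  have 1: "chi (-2) = 1 \<and> chi 6 = 1" if r: "p mod 24 = 1"
  proof -
    have m: "m = 12 * j" using p_eq pj unfolding r by linarith
    moreover have "m - m div 2 = 6 * j" unfolding m by presburger
    moreover have "int p mod 3 = 1" using r by (simp add: int_p_mod_3)
    moreover have "p \<noteq> 3" using r by auto
    ultimately show ?thesis
      using chi_3 unfolding chi2 chi_minus_1 chi_2 Legendre_3 by simp
  qed
  have 19: "chi (-2) = 1 \<and> chi 6 = 1" if r: "p mod 24 = 19"
  proof -
    have m: "m = 12 * j + 9" using p_eq pj unfolding r by linarith
    moreover have "m - m div 2 = 6 * j + 5" unfolding m by presburger
    moreover have "int p mod 3 = 1" using r by (simp add: int_p_mod_3)
    moreover have "p \<noteq> 3" using r by auto
    ultimately show ?thesis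
      using chi_3 unfolding chi2 chi_minus_1 chi_2 Legendre_3 by simp
  qed
  have 5: "chi (-2) = -1 \<and> chi 6 = 1" if r: "p mod 24 = 5"
  proof -
    have m: "m = 12 * j + 2" using p_eq pj unfolding r by linarith
    moreover have "m - m div 2 = 6 * j + 1" unfolding m by presburger
    moreover have "int p mod 3 = 2" using r by (simp add: int_p_mod_3)
    moreover have "p \<noteq> 3" using r by auto
    ultimately show ?thesis
      using chi_3 unfolding chi2 chi_minus_1 chi_2 Legendre_3 by simp
  qed
  have 23: "chi (-2) = -1 \<and> chi 6 = 1" if r: "p mod 24 = 23"
  proof -
    have m: "m = 12 * j + 11" using p_eq pj unfolding r by linarith
    moreover have "m - m div 2 = 6 * j + 6" unfolding m by presburger
    moreover have "int p mod 3 = 2" using r by (simp add: int_p_mod_3)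
    moreover have "p \<noteq> 3" using r by auto
    ultimately show ?thesis
      using chi_3 unfolding chi2 chi_minus_1 chi_2 Legendre_3 by simp
  qed
  show "chi (-2) = 1 \<and> chi 6 = 1" if "p mod 24 \<in> {1, 19}" using 1 19 that by blast
  show "chi (-2) = -1 \<and> chi 6 = 1" if "p mod 24 \<in> {5, 23}" using 5 23 that by blast
qed

section \<open>The parameter of the isogeny\<close>

lemma not_dvd_other_prime: "prime q \<Longrightarrow> p \<noteq> q \<Longrightarrow> \<not> int p dvd int q"
  using primes_dvd_imp_eq[OF p_prime] of_nat_dvd_iff[of p q, where 'a = int] by auto

text \<open>With \<open>q = r + 1\<close> the relation becomes \<open>2 r^2 = 3\<close>, which is solved modulo \<open>p\<close> by half of a square
  root of \<open>6\<close> and then lifted to \<open>p^2\<close> by Newton's method.\<close>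

lemma ex_isogeny_parameter:
  assumes "chi 6 = 1" and "p \<noteq> 3"
  shows "\<exists>q. [2 * q ^ 2 = 4 * q + 1] (mod int p ^ 2)"
proof -
  obtain s where s: "[s ^ 2 = 6] (mod int p)" using chi_eq_1D[OF assms(1)] by blast
  \<comment> \<open>\<open>m + 1\<close> is the inverse of \<open>2\<close> modulo \<open>p\<close>\<close>
  define r0 where "r0 = s * (int m + 1)"
  have r0: "[2 * r0 ^ 2 = 3] (mod int p)"
  proof -
    have "(2 * r0) ^ 2 = s ^ 2 * (int p + 1) ^ 2" by (simp add: r0_def int_p_eq power2_eq_square algebra_simps)
    also have "[\<dots> = 6 * 1 ^ 2] (mod int p)"
      by (intro cong_mult s cong_pow) (simp add: cong_iff_dvd_diff)
    finally have "[2 * (2 * r0 ^ 2) = 2 * 3] (mod int p)" by (simp add: power_mult_distrib)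
    thus ?thesis by (rule cong_mult_cancel[OF not_dvd_2])
  qed
  then obtain e where e: "2 * r0 ^ 2 - 3 = int p * e" by (auto simp: cong_iff_dvd_diff)
  have n3: "\<not> int p dvd 3"
 using not_dvd_other_prime[of 3] assms(2) by simp
  have nr0: "\<not> int p dvd r0"
  proof
    assume "int p dvd r0"
    hence "int p dvd 2 * r0 ^ 2" by (simp add: power2_eq_square)
    moreover have "3 = 2 * r0 ^ 2 - int p * e" using e by simp
    ultimately have "int p dvd 3" by (metis dvd_diff dvd_triv_left)
    thus False using n3 by simp
  qed
  have "\<not> int p dvd 4 * r0" using not_dvd_mult[OF not_dvd_power2[of 2] nr0] by simp
  hence "int p dvd 4 * r0 * recip (4 * r0) - 1" using recip by (simp add: cong_iff_dvd_diff)
  then obtain f where f: "4 * r0 * recip (4 * r0) - 1 = int p * f" by blast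
  define t where "t = - e * recip (4 * r0)"
  have "2 * (r0 + int p * t) ^ 2 - 3 = (2 * r0 ^ 2 - 3) + int p * (4 * r0 * t) + int p ^ 2 * (2 * t ^ 2)"
    by (simp add: power2_eq_square algebra_simps)
  also have "4 * r0 * t = - e * (4 * r0 * recip (4 * r0) - 1) - e" by (simp add: t_def algebra_simps)
  also have "(2 * r0 ^ 2 - 3) + int p * (- e * (4 * r0 * recip (4 * r0) - 1) - e) + int p ^ 2 * (2 * t ^ 2)
      = int p ^ 2 * (2 * t ^ 2 - e * f)"
    unfolding e f by (simp add: power2_eq_square algebra_simps)
  finally have "int p ^ 2 dvd 2 * (r0 + int p * t) ^ 2 - 3" by simp
  moreover have "2 * (r + 1) ^ 2 - (4 * (r + 1) + 1) = 2 * r ^ 2 - 3" for r :: int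
    by (simp add: power2_eq_square algebra_simps)
  ultimately have "[2 * (r0 + int p * t + 1) ^ 2 = 4 * (r0 + int p * t + 1) + 1] (mod int p ^ 2)"
    by (simp only: cong_iff_dvd_diff)
  thus ?thesis by blast
qed

text \<open>The argument is \<open>x = (9 + 40 q) / 6272\<close>, for which \<open>18 + 80 q = 16 * 28^2 x\<close> identifies the truncated
  series at \<open>x\<close> with the Hasse invariant of the isogenous curve.\<close>

lemma ex_clausen_argument:
  assumes chi6: "chi 6 = 1" and p3: "p \<noteq> 3" and p7: "p \<noteq> 7"
  shows "\<exists>x. [28 ^ 4 * (x * (1 - 64 * x)) = 1] (mod int p ^ 2)
    \<and> int p dvd (\<Sum>k<p. acoeff k * x ^ k) ^ 2 - cubic_sum ^ 2 \<and> (cubic_sum = 0 \<longrightarrow> int p dvd (\<Sum>k<p. acoeff k * x ^ k))"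
proof -
  obtain q where q: "[2 * q ^ 2 = 4 * q + 1] (mod int p ^ 2)" using ex_isogeny_parameter[OF chi6 p3] by blast
  have n7: "\<not> int p dvd 7"
 using not_dvd_other_prime[of 7] p7 by simp
  have n28: "\<not> int p dvd 28" using not_dvd_mult[OF not_dvd_power2[of 2] n7] by simp
  \<comment> \<open>This is \<open>6272\<close>\<close>
  have "\<not> int p dvd 2 ^ 7 * (7 * 7)" by (intro not_dvd_mult not_dvd_power2 n7)
  hence "coprime (6272 :: int) (int p ^ 2)"
    using prime_imp_coprime[OF prime_int_p, of 6272] by (simp add: coprime_commute)
  then obtain j where j: "[6272 * j = 1] (mod int p ^ 2)" using cong_solve_coprime_int by blast
  define y where "y = 9 + 40 * q"
  define x where "x = y * j"
  have x: "[6272 * x = y] (mod int p ^ 2)"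
    using cong_mult[OF cong_refl[of y] j] by (simp add: x_def ac_simps)
  have "28 ^ 4 * (x * (1 - 64 * x)) = (6272 * x) * (98 - 6272 * x)" by (simp add: algebra_simps)
  also have "[\<dots> = y * (98 - y)] (mod int p ^ 2)" by (intro cong_mult cong_diff x cong_refl)
  also have "y * (98 - y) = 801 + 3200 * q - 800 * (2 * q ^ 2)" by (simp add: y_def power2_eq_square algebra_simps)
  also have "[801 + 3200 * q - 800 * (2 * q ^ 2) = 801 + 3200 * q - 800 * (4 * q + 1)] (mod int p ^ 2)"
    by (intro cong_mult cong_diff cong_add q cong_refl)
  finally have arg: "[28 ^ 4 * (x * (1 - 64 * x)) = 1] (mod int p ^ 2)" by simp
  have down: "[a = b] (mod int p)" if "[a = b] (mod int p ^ 2)" for a b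
    using that by (rule cong_dvd_modulus) (simp add: power2_eq_square)
  have "[2 * (6272 * x) = 2 * y] (mod int p)" by (intro cong_mult cong_refl down x)
  hence "[18 + 80 * q = 16 * 28 ^ 2 * x] (mod int p)" by (simp add: y_def cong_sym)
  hence H: "[H 28 (18 + 80 * q) = 28 ^ m * (\<Sum>k<p. acoeff k * x ^ k)] (mod int p)"
    by (rule H_cong_hypergeometric)
  let ?f = "\<Sum>k<p. acoeff k * x ^ k"
  have fH: "[28 ^ m * ?f = H 4 2] (mod int p)"
    using cong_trans[OF cong_sym[OF H] H_isogeny[OF down[OF q]]] .
  have "[- cubic_sum = - (- H 4 2)] (mod int p)"
    using cubic_sum_cong unfolding cong_minus_minus_iff H_def .
  hence f: "[28 ^ m * ?f = - cubic_sum] (mod int p)"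
    unfolding minus_minus by (rule cong_trans[OF fH cong_sym])
  have f1: "[chi 28 * ?f = - cubic_sum] (mod int p)"
    using cong_trans[OF cong_mult[OF chi_euler[of 28] cong_refl] f] .
  have "[(chi 28 * ?f) ^ 2 = (- cubic_sum) ^ 2] (mod int p)" by (rule cong_pow[OF f1])
  moreover have "(chi 28 * ?f) ^ 2 = ?f ^ 2"
    using chi_square[OF n28] by (simp add: power_mult_distrib power2_eq_square[of "chi 28"])
  ultimately have f2: "int p dvd ?f ^ 2 - cubic_sum ^ 2" by (simp add: cong_iff_dvd_diff)
  moreover have "int p dvd ?f" if "cubic_sum = 0"
    using f2 that prime_dvd_power[OF prime_int_p] by fastforce
  ultimately show ?thesis using arg by blast
qed

section \<open>The congruences\<close>

lemma p_integersI:
  assumes "\<not> int p dvd d"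
  shows "of_int a / of_int d \<in> p_integers p"
proof -
  let ?r = "of_int a / of_int d :: rat"
  have d0: "d \<noteq> 0" using assms by auto
  obtain n e where ne: "quotient_of ?r = (n, e)" by (cases "quotient_of ?r")
  have e: "e > 0" "coprime n e" using ne quotient_of_denom_pos quotient_of_coprime by blast+
  have "of_int a / of_int d = (of_int n / of_int e :: rat)" using quotient_of_div[OF ne] .
  hence "of_int (a * e) = (of_int (n * d) :: rat)" using d0 e by (simp add: field_simps)
  hence "a * e = n * d" by (simp only: of_int_eq_iff)
  hence "e dvd n * d" by (metis dvd_triv_right)
  hence "e dvd d" using e by (simp add: coprime_commute coprime_dvd_mult_right_iff)
  moreover have "coprime d (int p)" using prime_imp_coprime[OF prime_int_p assms] by (simp add: coprime_commute)
  ultimately have "coprime e (int p)" by (rule coprime_divisors[OF _ dvd_refl])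
  thus ?thesis by (simp add: p_integers_def ne)
qed

text \<open>The sum times \<open>28^(4 (p - 1))\<close> is an integer, which is compared with the square of the truncated
  series by means of Clausen's formula.\<close>

lemma rat_cong_pow_sum:
  fixes x N :: int
  assumes x: "[28 ^ 4 * (x * (1 - 64 * x)) = 1] (mod int p ^ 2)" and p7: "\<not> int p dvd 28"
    and N: "[(\<Sum>k<p. acoeff k * x ^ k) ^ 2 = N] (mod int p ^ e)" and e: "e \<le> 2"
  shows "rat_cong_pow (\<Sum>k = 0..p - 1. of_nat (((2 * k) choose k)\<^sup>2 * ((4 * k) choose (2 * k))) / 28 ^ (4 * k)) (of_int N) p e"
proof -
  let ?S = "\<Sum>k = 0..p - 1. of_nat (((2 * k) choose k)\<^sup>2 * ((4 * k) choose (2 * k))) / 28 ^ (4 * k) :: rat"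
  let ?z = "x * (1 - 64 * x)"
  define d :: int where "d = 28 ^ (4 * (p - 1))"
  define M where "M = (\<Sum>k<p. bcoeff k * 28 ^ (4 * (p - 1 - k)))"
  have nd: "\<not> int p dvd d" using p7 prime_dvd_power[OF prime_int_p] by (auto simp: d_def)
  have "?S = (\<Sum>k<p. of_int (bcoeff k * 28 ^ (4 * (p - 1 - k))) / of_int d)"
  proof (rule sum.cong)
    show "{0..p - 1} = {..<p}" using p_gt_2 by auto
    fix k assume "k \<in> {..<p}"
    hence "4 * (p - 1) = 4 * (p - 1 - k) + 4 * k" by simp
    hence "d = 28 ^ (4 * (p - 1 - k)) * 28 ^ (4 * k)" by (simp only: d_def power_add)
    thus "of_nat (((2 * k) choose k)\<^sup>2 * ((4 * k) choose (2 * k))) / 28 ^ (4 * k)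
        = (of_int (bcoeff k * 28 ^ (4 * (p - 1 - k))) / of_int d :: rat)"
      by (simp add: bcoeff_def)
  qed
  hence S: "?S = of_int M / of_int d" by (simp only: M_def of_int_sum sum_divide_distrib)
  have "[M = (\<Sum>k<p. d * (bcoeff k * ?z ^ k))] (mod int p ^ 2)"
    unfolding M_def
  proof (rule cong_sum)
    fix k assume "k \<in> {..<p}"
    hence k: "4 * (p - 1) = 4 * (p - 1 - k) + 4 * k" by simp
    have "[bcoeff k * 28 ^ (4 * (p - 1 - k)) * 1 ^ k = bcoeff k * 28 ^ (4 * (p - 1 - k)) * (28 ^ 4 * ?z) ^ k] (mod int p ^ 2)"
      by (intro cong_mult cong_refl cong_pow cong_sym[OF x])
    also have "bcoeff k * 28 ^ (4 * (p - 1 - k)) * (28 ^ 4 * ?z) ^ k = d * (bcoeff k * ?z ^ k)"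
    proof -
      have "(28 ^ 4 * ?z) ^ k = 28 ^ (4 * k) * ?z ^ k" by (simp only: power_mult_distrib power_mult)
      thus ?thesis unfolding d_def k power_add by (simp only: ac_simps)
    qed
    finally show "[bcoeff k * 28 ^ (4 * (p - 1 - k)) = d * (bcoeff k * ?z ^ k)] (mod int p ^ 2)" by simp
  qed
  hence "[M = d * (\<Sum>k<p. bcoeff k * ?z ^ k)] (mod int p ^ 2)" unfolding sum_distrib_left .
  moreover have "[d * (\<Sum>k<p. bcoeff k * ?z ^ k) = d * (\<Sum>k<p. acoeff k * x ^ k) ^ 2] (mod int p ^ 2)"
    by (intro cong_mult cong_refl clausen_truncated[OF p_prime])
  ultimately have "[M = d * (\<Sum>k<p. acoeff k * x ^ k) ^ 2] (mod int p ^ 2)" by (rule cong_trans)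
  hence "[M = d * (\<Sum>k<p. acoeff k * x ^ k) ^ 2] (mod int p ^ e)"
    by (rule cong_dvd_modulus) (rule le_imp_power_dvd[OF e])
  moreover have "[d * (\<Sum>k<p. acoeff k * x ^ k) ^ 2 = d * N] (mod int p ^ e)" by (intro cong_mult cong_refl N)
  ultimately have "[M = d * N] (mod int p ^ e)" by (rule cong_trans)
  then obtain c where c: "M - d * N = int p ^ e * c" by (auto simp: cong_iff_dvd_diff)
  have d0: "of_int d \<noteq> (0::rat)" using nd by auto
  have "?S - of_int N = of_int (M - d * N) / of_int d" unfolding S using d0 by (simp add: field_simps)
  also have "\<dots> = of_nat p ^ e * (of_int c / of_int d)" unfolding c by simp
  finally have "?S - of_int N = of_nat p ^ e * (of_int c / of_int d)" .
  moreover have "of_int N / of_int 1 \<in> p_integers p" by (rule p_integersI) (use p_gt_2 in simp)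
  ultimately show ?thesis
    unfolding rat_cong_pow_def S
    by (intro conjI bexI[of _ "of_int c / of_int d"] p_integersI[OF nd]) simp_all
qed

end

theorem theorem3p9:
  fixes p :: nat
  assumes "prime p" and "odd p" and "p mod 24 \<in> {1, 5, 19, 23}"
  defines "S \<equiv> (\<Sum>k = 0..p - 1. of_nat (((2 * k) choose k)\<^sup>2 * ((4 * k) choose (2 * k))) / 28 ^ (4 * k) :: rat)"
  shows "(p mod 24 \<in> {1, 19} \<longrightarrow>
            (\<exists>x y :: int. int p = x\<^sup>2 + 18 * y\<^sup>2) \<and>
            (\<forall>x y :: int. int p = x\<^sup>2 + 18 * y\<^sup>2 \<longrightarrow> rat_cong_pow S (of_int (4 * x\<^sup>2)) p 1)) \<and>
         (p mod 24 \<in> {5, 23} \<longrightarrow> rat_cong_pow S 0 p 2)"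
proof -
  interpret odd_prime p by unfold_locales fact+
  have p37: "p \<noteq> 3" "p \<noteq> 7" using assms(3) by auto
  have chi6: "chi 6 = 1" using chi_values_mod_24 assms(3) by auto
  obtain t where t: "[28 ^ 4 * (t * (1 - 64 * t)) = 1] (mod int p ^ 2)"
    and f: "int p dvd (\<Sum>k<p. acoeff k * t ^ k) ^ 2 - cubic_sum ^ 2"
    and f0: "cubic_sum = 0 \<Longrightarrow> int p dvd (\<Sum>k<p. acoeff k * t ^ k)"
    using ex_clausen_argument[OF chi6 p37] by blast
  have n28: "\<not> int p dvd 28"
  proof
    assume "int p dvd 28"
    hence "int p dvd 28 ^ 4 * (t * (1 - 64 * t))" by (intro dvd_mult2 dvd_trans[OF _ dvd_power]) simp_all
    moreover have "[28 ^ 4 * (t * (1 - 64 * t)) = 1] (mod int p)"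
      using t by (rule cong_dvd_modulus) (simp add: power2_eq_square)
    ultimately show False using p_gt_2 cong_dvd_iff by fastforce
  qed
  show ?thesis
  proof (intro conjI impI allI)
    assume p: "p mod 24 \<in> {1, 19}"
    hence "chi (-2) = 1" using chi_values_mod_24 by blast
    then obtain a b where ab: "int p = a ^ 2 + 2 * b ^ 2" and a: "cubic_sum = 2 * a" using cubic_sum_norm_equation by blast
    show "\<exists>x y :: int. int p = x\<^sup>2 + 18 * y\<^sup>2"
    proof -
      have p3: "int p mod 3 = 1" using p by (auto simp: int_p_mod_3)
      have "b mod 3 = 0"
      proof (rule ccontr)
        assume "b mod 3 \<noteq> 0"
        hence "b mod 3 = 1 \<or> b mod 3 = 2" by presburger
        hence b: "b ^ 2 mod 3 = 1" by (subst power_mod[symmetric]) auto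
        have "a mod 3 = 0 \<or> a mod 3 = 1 \<or> a mod 3 = 2" by presburger
        hence "a ^ 2 mod 3 = 0 \<or> a ^ 2 mod 3 = 1" by (subst (1 2) power_mod[symmetric]) auto
        hence "(a ^ 2 + 2 * b ^ 2) mod 3 \<noteq> 1" using b by presburger
        thus False using p3 ab by simp
      qed
      then obtain y where "b = 3 * y" by auto
      hence "int p = a ^ 2 + 18 * y ^ 2" using ab by (simp add: power_mult_distrib)
      thus ?thesis by blast
    qed
    fix x y :: int assume "int p = x\<^sup>2 + 18 * y\<^sup>2"
    hence "int p = x ^ 2 + 2 * (3 * y) ^ 2" by (simp add: power_mult_distrib)
    hence "x ^ 2 = a ^ 2" using representation_unique[OF ab] by blast
    hence "[(\<Sum>k<p. acoeff k * t ^ k) ^ 2 = 4 * x ^ 2] (mod int p ^ 1)"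
      using f unfolding a by (simp add: cong_iff_dvd_diff power_mult_distrib)
    thus "rat_cong_pow S (of_int (4 * x\<^sup>2)) p 1"
      unfolding S_def by (intro rat_cong_pow_sum[OF t n28]) simp_all
  next
    assume "p mod 24 \<in> {5, 23}"
    hence "chi (-2) = -1" using chi_values_mod_24 by blast
    hence "cubic_sum = 0" using cubic_sum_twist by simp
    hence "int p ^ 2 dvd (\<Sum>k<p. acoeff k * t ^ k) ^ 2" using f0 by (intro dvd_power_same)
    hence "[(\<Sum>k<p. acoeff k * t ^ k) ^ 2 = 0] (mod int p ^ 2)" by (simp add: cong_0_iff)
    hence "rat_cong_pow S (of_int 0) p 2"
      unfolding S_def by (intro rat_cong_pow_sum[OF t n28]) simp_all
    thus "rat_cong_pow S 0 p 2" by simp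
  qed
qed

end
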